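(* Let $K$ be a convex set in the plane $\mathbb{R}^2$ with area $1$. Let $K_n$ be a set of $n$ points chosen independently and uniformly at random from $K$. Let $\mathrm{PolyMax}(K_n)$ denote the random variable that measures the largest area of a convex polygon that has all its vertices in $K_n$ and is a $K_n$-hole. Then w.h.p. $$(1+o(1))\frac{\log n}{n} \le \mathrm{PolyMax}(K_n) \le (4+o(1))\frac{\log n}{n}.$$
   Context: A $K_n$-hole (or simply a hole) is a subset of $K$ whose interior does not contain any point of $K_n$. $\log$ is the natural logarithm. "W.h.p." (with high probability) means with probability tending to $1$ as $n\to\infty$, with $K$ fixed; the conclusion means: for every $\epsilon>0$, the probability that $(1-\epsilon)\frac{\log n}{n}\le \mathrm{PolyMax}(K_n)\le (4+\epsilon)\frac{\log n}{n}$ tends to $1$ as $n\to\infty$. *)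

theory Defs
  imports "HOL-Probability.Probability"
begin

definition hole :: "(real^2) set \<Rightarrow> (real^2) set \<Rightarrow> (real^2) set \<Rightarrow> bool" where
  "hole K P Q \<longleftrightarrow> Q \<subseteq> K \<and> interior Q \<inter> P = {}"

(* The dimension condition excludes degenerate polygons: the empty set, points and segments. *)
definition convex_polygon :: "(real^2) set \<Rightarrow> bool" where
  "convex_polygon Q \<longleftrightarrow> polytope Q \<and> aff_dim Q = 2"

definition vertices :: "(real^2) set \<Rightarrow> (real^2) set" where
  "vertices Q = {v. v extreme_point_of Q}"

definition polygonal_holes :: "(real^2) set \<Rightarrow> (real^2) set \<Rightarrow> (real^2) set set" where
  "polygonal_holes K P = {Q. convex_polygon Q \<and> vertices Q \<subseteq> P \<and> hole K P Q}"

(* The value is 0 if there is no polygonal hole, for instance if P is collinear. *)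
definition PolyMax :: "(real^2) set \<Rightarrow> (real^2) set \<Rightarrow> real" where
  "PolyMax K P = Max (insert 0 (measure lebesgue ` polygonal_holes K P))"

(* Hence the maximum above is attained for finite P. *)
lemma finite_polygonal_holes:
  assumes "finite P"
  shows "finite (polygonal_holes K P)"
proof (rule finite_subset)
  show "polygonal_holes K P \<subseteq> (\<lambda>V. convex hull V) ` Pow P"
  proof
    fix Q assume Q: "Q \<in> polygonal_holes K P"
    then have "polytope Q" and V: "vertices Q \<subseteq> P"
      by (auto simp: polygonal_holes_def convex_polygon_def)
    then have "Q = convex hull (vertices Q)"
      unfolding vertices_def
      by (intro Krein_Milman_Minkowski polytope_imp_compact polytope_imp_convex)
    with V show "Q \<in> (\<lambda>V. convex hull V) ` Pow P" by blast
  qed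
  show "finite ((\<lambda>V. convex hull V) ` Pow P)" using assms by simp
qed

(* The law of n independent uniform points of K, as a family x indexed by i < n. The point set
   is x ` {..<n}, which almost surely has n elements. Lebesgue rather than Borel measure is
   used because a convex set need not be Borel. *)
definition uniform_points :: "(real^2) set \<Rightarrow> nat \<Rightarrow> (nat \<Rightarrow> real^2) measure" where
  "uniform_points K n = PiM {..<n} (\<lambda>_. uniform_measure lebesgue K)"

end

theory Submission
  imports Defs "HOL-Real_Asymp.Real_Asymp"
begin

text \<open>Upper bound: let \<open>a, b, c\<close> be vertices of a polygonal hole \<open>Q\<close> spanning a triangle of maximal
  area. In the affine frame \<open>(a, b - a, c - a)\<close> the polygon lies between the standard triangle and
  \<open>[-1, 1]\<^sup>2\<close>, so a fixed finite grid suffices to find inside the interior of \<open>Q\<close> a convex hull of grid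
  points with at least \<open>(19/20)\<^sup>2\<close> of the area of \<open>Q\<close>. The remaining \<open>n - 3\<close> points all miss this hull,
  and a union bound over the three vertices and the constantly many hulls gives
  \<open>O(n\<^sup>3 (1 - (19/20)\<^sup>2 4 log n / n)\<^bsup>n - 3\<^esup>)\<close>, which tends to 0 because \<open>4 (19/20)\<^sup>2 > 3\<close>.

  Lower bound: tile a fixed square inside \<open>K\<close> by squares of area \<open>(1 - \<epsilon>/2) log n / n\<close>. If such a square
  has no random point outside its four small corner squares, but a point in each of these, then
  suitable points in the corners span a hole containing the inner square. The expected number of
  such squares tends to infinity, and the second moment method shows that w.h.p. there is one.\<close>

section \<open>Measurability of the largest polygonal hole\<close>

lemma dense_sequence_exists:
  "\<exists>d :: nat \<Rightarrow> 'a::second_countable_topology. \<forall>X. open X \<longrightarrow> X \<noteq> {} \<longrightarrow> (\<exists>u\<in>range d. u \<in> X)"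
proof -
  obtain D :: "'a set" where D: "countable D" "\<forall>X. open X \<longrightarrow> X \<noteq> {} \<longrightarrow> (\<exists>u\<in>D. u \<in> X)"
    using countable_dense_exists by metis
  then have "D \<noteq> {}" by (metis UNIV_I empty_iff open_UNIV)
  then have "range (from_nat_into D) = D" using D(1) by (rule range_from_nat_into)
  with D(2) show ?thesis by metis
qed

text \<open>A point outside the closed hull can be separated from it strictly. Strict separation
  from finitely many points survives small changes of the direction, so it also occurs for a
  direction in the dense set.\<close>

lemma hull_mem_iff_dense:
  fixes S :: "'a::euclidean_space set"
  assumes "finite S" and dense: "\<forall>X. open X \<longrightarrow> X \<noteq> {} \<longrightarrow> (\<exists>u\<in>D. u \<in> (X :: 'a set))"
  shows "y \<in> convex hull S \<longleftrightarrow> (\<forall>u\<in>D. \<exists>v\<in>S. u \<bullet> y \<le> u \<bullet> v)"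
proof
  assume y: "y \<in> convex hull S"
  show "\<forall>u\<in>D. \<exists>v\<in>S. u \<bullet> y \<le> u \<bullet> v"
  proof (rule ballI, rule ccontr)
    fix u assume "\<not> (\<exists>v\<in>S. u \<bullet> y \<le> u \<bullet> v)"
    then have "S \<subseteq> {z. u \<bullet> z < u \<bullet> y}" by auto
    then have "convex hull S \<subseteq> {z. u \<bullet> z < u \<bullet> y}"
      by (rule hull_minimal) (rule convex_halfspace_lt)
    with y show False by auto
  qed
next
  assume H: "\<forall>u\<in>D. \<exists>v\<in>S. u \<bullet> y \<le> u \<bullet> v"
  show "y \<in> convex hull S"
  proof (rule ccontr)
    assume "y \<notin> convex hull S"
    moreover have "closed (convex hull S)"
      using assms(1) by (simp add: compact_imp_closed finite_imp_compact_convex_hull)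
    ultimately obtain a b where ab: "a \<bullet> y < b" "\<forall>x\<in>convex hull S. a \<bullet> x > b"
      using separating_hyperplane_closed_point[of "convex hull S" y] by auto
    let ?X = "\<Inter>v\<in>S. {u. u \<bullet> v < u \<bullet> y}"
    have "open ?X" using assms(1) by (intro open_INT ballI open_Collect_less continuous_intros)
    \<comment> \<open>The separating hyperplane has the hull on its larger side, hence the change of
      sign.\<close>
    moreover have "- a \<in> ?X"
    proof (rule INT_I)
      fix v assume "v \<in> S"
      then have "v \<in> convex hull S" by (rule hull_inc)
      then show "- a \<in> {u. u \<bullet> v < u \<bullet> y}" using ab by fastforce
    qed
    ultimately obtain u where "u \<in> D" "u \<in> ?X" using dense[rule_format, of ?X] by blast
    with H show False by force
  qed
qed

text \<open>Membership amounts to countably many linear comparisons, one for each direction of a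
  dense sequence, so it is measurable although both the point and the hull vary.\<close>

lemma pred_mem_convex_hull:
  fixes f :: "'i \<Rightarrow> 'm \<Rightarrow> 'a::euclidean_space"
  assumes "finite I" and f: "\<And>i. i \<in> I \<Longrightarrow> f i \<in> borel_measurable M"
    and g: "g \<in> borel_measurable M"
  shows "Measurable.pred M (\<lambda>x. g x \<in> convex hull ((\<lambda>i. f i x) ` I))"
proof -
  obtain d :: "nat \<Rightarrow> 'a" where d: "\<forall>X. open X \<longrightarrow> X \<noteq> {} \<longrightarrow> (\<exists>u\<in>range d. u \<in> X)"
    using dense_sequence_exists[where 'a='a] by blast
  have "Measurable.pred M (\<lambda>x. \<forall>n. \<exists>i\<in>I. d n \<bullet> g x \<le> d n \<bullet> f i x)"
    using assms(1) f g
    by (intro pred_intros_countable pred_intros_finite) auto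
  moreover have "g x \<in> convex hull ((\<lambda>i. f i x) ` I) \<longleftrightarrow> (\<forall>n. \<exists>i\<in>I. d n \<bullet> g x \<le> d n \<bullet> f i x)" for x
    by (subst hull_mem_iff_dense[OF _ d]) (use assms(1) in auto)
  ultimately show ?thesis by simp
qed

text \<open>The part of a ball outside a closed \<open>C\<close> is open, so if nonempty it contains
  a point of the form \<open>y + u\<close> with \<open>u\<close> in the dense set. With a countable
  \<open>D\<close>, interiority becomes a countable condition.\<close>

lemma mem_interior_closed_iff_dense:
  fixes C :: "'a::euclidean_space set"
  assumes "closed C" and dense: "\<forall>X. open X \<longrightarrow> X \<noteq> {} \<longrightarrow> (\<exists>u\<in>D. u \<in> (X :: 'a set))"
  shows "y \<in> interior C \<longleftrightarrow> (\<exists>k::nat. \<forall>u\<in>D. norm u < 1 / real (Suc k) \<longrightarrow> y + u \<in> C)"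
proof
  assume "y \<in> interior C"
  then obtain e where e: "e > 0" "ball y e \<subseteq> C" by (auto simp: mem_interior)
  obtain k where k: "1 / real (Suc k) < e" using nat_approx_posE[OF e(1)] by blast
  have "y + u \<in> C" if "norm u < 1 / real (Suc k)" for u
  proof -
    have "y + u \<in> ball y e" using that k by (simp add: dist_norm)
    with e show ?thesis by blast
  qed
  then show "\<exists>k::nat. \<forall>u\<in>D. norm u < 1 / real (Suc k) \<longrightarrow> y + u \<in> C" by blast
next
  assume "\<exists>k::nat. \<forall>u\<in>D. norm u < 1 / real (Suc k) \<longrightarrow> y + u \<in> C"
  then obtain k :: nat where k: "\<forall>u\<in>D. norm u < 1 / real (Suc k) \<longrightarrow> y + u \<in> C" by blast
  have "ball y (1 / real (Suc k)) \<subseteq> C"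
  proof (rule ccontr)
    assume "\<not> ball y (1 / real (Suc k)) \<subseteq> C"
    then have ne: "(\<lambda>z. z - y) ` (ball y (1 / real (Suc k)) - C) \<noteq> {}" by blast
    moreover have "open ((\<lambda>z. z - y) ` (ball y (1 / real (Suc k)) - C))"
      using assms(1) by (intro open_translation_subtract open_Diff) auto
    ultimately obtain u where "u \<in> D" "u \<in> (\<lambda>z. z - y) ` (ball y (1 / real (Suc k)) - C)"
      using dense by blast
    with k show False by (auto simp: dist_norm norm_minus_commute)
  qed
  then show "y \<in> interior C" by (auto simp: mem_interior intro!: exI[of _ "1 / real (Suc k)"])
qed

lemma pred_mem_interior_convex_hull:
  fixes f :: "'i \<Rightarrow> 'm \<Rightarrow> 'a::euclidean_space"
  assumes "finite I" and f: "\<And>i. i \<in> I \<Longrightarrow> f i \<in> borel_measurable M"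
    and g: "g \<in> borel_measurable M"
  shows "Measurable.pred M (\<lambda>x. g x \<in> interior (convex hull ((\<lambda>i. f i x) ` I)))"
proof -
  obtain d :: "nat \<Rightarrow> 'a" where d: "\<forall>X. open X \<longrightarrow> X \<noteq> {} \<longrightarrow> (\<exists>u\<in>range d. u \<in> X)"
    using dense_sequence_exists[where 'a='a] by blast
  have "Measurable.pred M (\<lambda>x. \<exists>k::nat. \<forall>n. norm (d n) < 1 / real (Suc k)
      \<longrightarrow> g x + d n \<in> convex hull ((\<lambda>i. f i x) ` I))"
    using assms
    by (intro pred_intros_countable pred_intros_logic pred_mem_convex_hull) auto
  moreover have "g x \<in> interior (convex hull ((\<lambda>i. f i x) ` I)) \<longleftrightarrow>
    (\<exists>k::nat. \<forall>n. norm (d n) < 1 / real (Suc k) \<longrightarrow> g x + d n \<in> convex hull ((\<lambda>i. f i x) ` I))" for x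
  proof -
    have cl: "closed (convex hull ((\<lambda>i. f i x) ` I))"
      using assms(1) by (intro compact_imp_closed finite_imp_compact_convex_hull finite_imageI)
    show ?thesis
    unfolding mem_interior_closed_iff_dense[OF cl d] by blast
  qed
  ultimately show ?thesis by (simp only:)
qed

text \<open>The pairs of a parameter and a point of its hull form a product-measurable set, and the
  measure of a section depends measurably on the parameter. This serves both \<open>lborel\<close>
  and the uniform measure on \<open>K\<close>.\<close>

lemma measurable_emeasure_convex_hull:
  fixes f :: "'i \<Rightarrow> 'm \<Rightarrow> 'a::euclidean_space"
  assumes "finite I" and f: "\<And>i. i \<in> I \<Longrightarrow> f i \<in> borel_measurable M"
    and N: "sigma_finite_measure N" "(\<lambda>y. y) \<in> borel_measurable N" "space N = UNIV"
  shows "(\<lambda>x. emeasure N (convex hull ((\<lambda>i. f i x) ` I))) \<in> borel_measurable M"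
proof -
  interpret sigma_finite_measure N by fact
  let ?Q = "{z \<in> space (M \<Otimes>\<^sub>M N). snd z \<in> convex hull ((\<lambda>i. f i (fst z)) ` I)}"
  have "?Q \<in> sets (M \<Otimes>\<^sub>M N)"
    using assms(1) f N(2)
    by (intro predE pred_mem_convex_hull measurable_compose[OF measurable_fst]
        measurable_compose[OF measurable_snd]) auto
  from measurable_emeasure_Pair[OF this]
  show ?thesis
    by (rule measurable_cong[THEN iffD1, rotated])
      (auto simp: space_pair_measure N(3) intro!: arg_cong[where f="emeasure N"])
qed

text \<open>The hull is compact, hence Borel, and completion does not change its area; measurability
  thus transfers from \<open>lborel\<close>.\<close>

lemma measure_lebesgue_convex_hull_finite:
  fixes S :: "'a::euclidean_space set"
  assumes "finite S"
  shows "measure lebesgue (convex hull S) = enn2real (emeasure lborel (convex hull S))"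
proof -
  have "convex hull S \<in> sets lborel"
    using assms by (simp add: borel_compact finite_imp_compact_convex_hull)
  from measure_completion[OF this] show ?thesis by (simp only: measure_def)
qed

lemma measure_lebesgue_nonfull_aff_dim:
  fixes S :: "'a::euclidean_space set"
  assumes "finite S" "aff_dim (convex hull S) \<noteq> DIM('a)"
  shows "measure lebesgue (convex hull S) = 0"
proof -
  have "interior (convex hull S) = {}"
    using aff_dim_nonempty_interior assms(2) by blast
  then have "negligible (convex hull S)"
    by (simp add: negligible_convex_interior)
  then show ?thesis
    by (simp add: negligible_imp_measure0)
qed

text \<open>The random family of polygons is replaced by the fixed family of index sets, so that
  measurability can be checked term by term. Index sets that do not span a polygonal hole contribute
  0, the value inserted in \<open>PolyMax\<close>.\<close>

lemma PolyMax_image_eq: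
  fixes x :: "nat \<Rightarrow> real^2"
  assumes "convex K"
  shows "PolyMax K (x ` {..<n}) = Max ((\<lambda>V. if (\<forall>i\<in>V. x i \<in> K) \<and>
      (\<forall>j\<in>{..<n}. x j \<notin> interior (convex hull (x ` V)))
      then measure lebesgue (convex hull (x ` V)) else 0) ` Pow {..<n})"
    (is "_ = Max (?g ` _)")
proof -
  let ?P = "x ` {..<n}"
  have "insert 0 (measure lebesgue ` polygonal_holes K ?P) = ?g ` Pow {..<n}" (is "?A = ?B")
  proof (intro equalityI subsetI)
    fix t assume "t \<in> ?A"
    then consider "t = 0" | Q where "Q \<in> polygonal_holes K ?P" "t = measure lebesgue Q" by blast
    then show "t \<in> ?B"
    proof cases
      case 1
      have "?g {} = 0" by simp
      with 1 show ?thesis by (intro image_eqI[of _ _ "{}"]) auto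
    next
      case 2
      then have Q: "polytope Q" "vertices Q \<subseteq> ?P" "Q \<subseteq> K" "interior Q \<inter> ?P = {}"
        by (auto simp: polygonal_holes_def convex_polygon_def hole_def)
      have hull: "Q = convex hull (vertices Q)"
        unfolding vertices_def using Q(1)
        by (intro Krein_Milman_Minkowski polytope_imp_compact polytope_imp_convex)
      obtain V where V: "V \<subseteq> {..<n}" "vertices Q = x ` V"
        using Q(2) by (meson subset_imageE)
      have "\<forall>i\<in>V. x i \<in> K"
        using Q(3) V(2) hull hull_subset[of "vertices Q" convex] by blast
      then have "?g V = t" using Q V hull 2(2) by auto
      with V(1) show ?thesis by blast
    qed
  next
    fix t assume "t \<in> ?B"
    then obtain V where V: "V \<subseteq> {..<n}" "t = ?g V" by blast
    show "t \<in> ?A"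
    proof (cases "t = 0")
      case False
      let ?Q = "convex hull (x ` V)"
      have fin: "finite (x ` V)" by (intro finite_imageI finite_subset[OF V(1)]) simp
      have C: "(\<forall>i\<in>V. x i \<in> K) \<and> (\<forall>j\<in>{..<n}. x j \<notin> interior ?Q)" (is ?C)
      proof (rule ccontr)
        assume "\<not> ?C"
        then have "?g V = 0" by (rule if_not_P)
        with V(2) False show False by metis
      qed
      have t: "t = measure lebesgue ?Q" by (rule trans[OF V(2) if_P[OF C]])
      \<comment> \<open>Nonzero area excludes points and segments.\<close>
      have "aff_dim ?Q = 2"
        using measure_lebesgue_nonfull_aff_dim[OF fin] False[unfolded t] by fastforce
      moreover have "polytope ?Q" using fin by (auto simp: polytope_def)
      moreover have "vertices ?Q \<subseteq> ?P"
        unfolding vertices_def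
        using extreme_points_of_convex_hull image_mono[OF V(1)] by (rule subset_trans)
      moreover have "?Q \<subseteq> K" using C assms by (intro hull_minimal) auto
      moreover have "interior ?Q \<inter> ?P = {}" using C by blast
      ultimately have "?Q \<in> polygonal_holes K ?P"
        by (simp add: polygonal_holes_def convex_polygon_def hole_def)
      with t show ?thesis by blast
    qed simp
  qed
  then show ?thesis unfolding PolyMax_def by (rule arg_cong)
qed

text \<open>Lebesgue measurability handles the event that a point lies in \<open>K\<close>, which
  may fail to be Borel; Borel measurability handles the constructions with hulls.\<close>

lemma uniform_points_component:
  assumes "i < n"
  shows "(\<lambda>x. x i) \<in> measurable (uniform_points K n) lebesgue"
    and "(\<lambda>x. x i) \<in> borel_measurable (uniform_points K n)"
proof -
  show *: "(\<lambda>x. x i) \<in> measurable (uniform_points K n) lebesgue"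
    unfolding uniform_points_def
    using measurable_component_singleton[of i "{..<n}" "\<lambda>_. uniform_measure lebesgue K"] assms
    by (simp cong: measurable_cong_sets)
  show "(\<lambda>x. x i) \<in> borel_measurable (uniform_points K n)"
    by (rule measurable_compose[OF *]) (rule measurable_completion, simp)
qed

lemma measurable_PolyMax:
  assumes "convex K" "K \<in> sets lebesgue"
  shows "(\<lambda>x. PolyMax K (x ` {..<n})) \<in> borel_measurable (uniform_points K n)"
proof -
  define g where "g V x = (if (\<forall>i\<in>V. x i \<in> K) \<and> (\<forall>j\<in>{..<n}. x j \<notin> interior (convex hull (x ` V)))
      then measure lebesgue (convex hull (x ` V)) else 0)" for V and x :: "nat \<Rightarrow> real^2"
  have "g V \<in> borel_measurable (uniform_points K n)" if "V \<in> Pow {..<n}" for V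
  proof -
    have V: "i < n" if "i \<in> V" for i using that \<open>V \<in> Pow {..<n}\<close> by blast
    have fin: "finite V" by (rule finite_subset[of _ "{..<n}"]) (use that in simp_all)
    have "Measurable.pred (uniform_points K n) (\<lambda>x. x i \<in> K)" if "i \<in> V" for i
      by (rule pred_sets2[OF assms(2) uniform_points_component(1)[OF V[OF that]]])
    moreover have "Measurable.pred (uniform_points K n) (\<lambda>x. x j \<in> interior (convex hull (x ` V)))"
      if "j < n" for j
      by (rule pred_mem_interior_convex_hull[where f="\<lambda>i x. x i", OF fin uniform_points_component(2) uniform_points_component(2)])
        (erule V, rule that)
    ultimately have "Measurable.pred (uniform_points K n)
        (\<lambda>x. (\<forall>i\<in>V. x i \<in> K) \<and> (\<forall>j\<in>{..<n}. x j \<notin> interior (convex hull (x ` V))))"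
      by (intro pred_intros_logic(3,5) pred_intros_finite(3) fin finite_lessThan) simp_all
    moreover have "(\<lambda>x. emeasure lborel (convex hull (x ` V))) \<in> borel_measurable (uniform_points K n)"
      by (rule measurable_emeasure_convex_hull[where f="\<lambda>i x. x i", OF fin uniform_points_component(2)])
        (simp_all add: V sigma_finite_lborel)
    then have "(\<lambda>x. measure lebesgue (convex hull (x ` V))) \<in> borel_measurable (uniform_points K n)"
      unfolding measure_lebesgue_convex_hull_finite[OF finite_imageI[OF fin]]
      by (rule measurable_compose) simp
    ultimately show ?thesis
      unfolding g_def by (intro measurable_If) (simp_all add: pred_def)
  qed
  then have "(\<lambda>x. Max ((\<lambda>V. g V x) ` Pow {..<n})) \<in> borel_measurable (uniform_points K n)"
    by (rule borel_measurable_Max[where f=g, rotated]) simp_all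
  then show ?thesis
    unfolding PolyMax_image_eq[OF assms(1)] g_def .
qed

section \<open>Inner approximation of a convex polygon\<close>

definition det2 :: "real^2 \<Rightarrow> real^2 \<Rightarrow> real" where
  "det2 u v = u $ 1 * v $ 2 - u $ 2 * v $ 1"

text \<open>Affine coordinates in which \<open>a\<close>, \<open>b\<close>, \<open>c\<close> become
  (0, 0), (1, 0), (0, 1). The determinant \<open>det2 (b - a) (c - a)\<close> is twice the signed
  area of this triangle.\<close>

definition frame :: "real^2 \<Rightarrow> real^2 \<Rightarrow> real^2 \<Rightarrow> real \<Rightarrow> real \<Rightarrow> real^2" where
  "frame a b c s t = a + s *\<^sub>R (b - a) + t *\<^sub>R (c - a)"

lemma frame_cramer:
  assumes "det2 (b - a) (c - a) \<noteq> 0"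
  shows "v = frame a b c (det2 (v - a) (c - a) / det2 (b - a) (c - a))
                         (det2 (b - a) (v - a) / det2 (b - a) (c - a))"
proof -
  let ?D = "det2 (b - a) (c - a)"
  have "?D * v $ 1 = ?D * a $ 1 + det2 (v - a) (c - a) * (b - a) $ 1 + det2 (b - a) (v - a) * (c - a) $ 1"
    and "?D * v $ 2 = ?D * a $ 2 + det2 (v - a) (c - a) * (b - a) $ 2 + det2 (b - a) (v - a) * (c - a) $ 2"
    by (simp_all add: det2_def algebra_simps)
  moreover have "x = p + X / ?D * q + Y / ?D * r" if "?D * x = ?D * p + X * q + Y * r" for x p X q Y r
    using that assms by (simp add: field_simps)
  ultimately show ?thesis
    by (simp add: vec_eq_iff forall_2 frame_def)
qed

lemma collinear_imp_det2_eq_0: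
  assumes "collinear {a, b, c}"
  shows "det2 (b - a) (c - a) = 0"
proof -
  obtain u where u: "\<forall>x\<in>{a,b,c}. \<forall>y\<in>{a,b,c}. \<exists>k. x - y = k *\<^sub>R u"
    using assms unfolding collinear_def by blast
  then obtain k l where "b - a = k *\<^sub>R u" "c - a = l *\<^sub>R u" by blast
  then show ?thesis by (simp add: det2_def)
qed

text \<open>Fix distinct \<open>a\<close> and \<open>b\<close>. A vanishing determinant makes
  \<open>x - a\<close> a multiple of \<open>b - a\<close>, the factor being read off from a nonzero
  coordinate of \<open>b - a\<close>.\<close>

lemma det2_eq_0_imp_collinear:
  assumes "\<And>a b c. a \<in> V \<Longrightarrow> b \<in> V \<Longrightarrow> c \<in> V \<Longrightarrow> det2 (b - a) (c - a) = 0"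
  shows "collinear V"
proof (cases "\<exists>a\<in>V. \<exists>b\<in>V. a \<noteq> b")
  case False
  then have "V = {} \<or> (\<exists>a. V = {a})" by blast
  then show ?thesis by auto
next
  case True
  then obtain a b where ab: "a \<in> V" "b \<in> V" "a \<noteq> b" by blast
  have "\<exists>k. x = a + k *\<^sub>R (b - a)" if "x \<in> V" for x
  proof -
    have d: "(b - a) $ 1 * (x - a) $ 2 = (b - a) $ 2 * (x - a) $ 1"
      using assms[OF ab(1,2) that] by (simp add: det2_def)
    have "(b - a) $ 1 \<noteq> 0 \<or> (b - a) $ 2 \<noteq> 0"
      using ab(3) by (auto simp: vec_eq_iff forall_2)
    then show ?thesis
    proof
      assume n: "(b - a) $ 1 \<noteq> 0"
      have "(x - a) $ 2 = (x - a) $ 1 / (b - a) $ 1 * (b - a) $ 2"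
        using d n by (simp add: nonzero_eq_divide_eq mult.commute)
      moreover have "(x - a) $ 1 = (x - a) $ 1 / (b - a) $ 1 * (b - a) $ 1"
        using n by simp
      ultimately have "x - a = ((x - a) $ 1 / (b - a) $ 1) *\<^sub>R (b - a)"
        by (simp add: vec_eq_iff forall_2)
      then show ?thesis by (metis add.commute diff_add_cancel)
    next
      assume n: "(b - a) $ 2 \<noteq> 0"
      have "(x - a) $ 1 = (x - a) $ 2 / (b - a) $ 2 * (b - a) $ 1"
        using d n by (simp add: nonzero_eq_divide_eq mult.commute)
      moreover have "(x - a) $ 2 = (x - a) $ 2 / (b - a) $ 2 * (b - a) $ 2"
        using n by simp
      ultimately have "x - a = ((x - a) $ 2 / (b - a) $ 2) *\<^sub>R (b - a)"
        by (simp add: vec_eq_iff forall_2)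
      then show ?thesis by (metis add.commute diff_add_cancel)
    qed
  qed
  then show ?thesis
    unfolding collinear_alt by blast
qed

text \<open>Since no triangle of \<^term>\<open>V\<close> is larger than \<open>abc\<close>, the coordinates given by Cramer's rule
  are at most 1 in absolute value.\<close>

lemma largest_triangle:
  assumes "finite V" "aff_dim V = 2"
  obtains a b c where "a \<in> V" "b \<in> V" "c \<in> V" "det2 (b - a) (c - a) > 0"
    and "\<And>v. v \<in> convex hull V \<Longrightarrow> \<exists>s t. v = frame a b c s t \<and> \<bar>s\<bar> \<le> 1 \<and> \<bar>t\<bar> \<le> 1"
proof -
  let ?T = "V \<times> V \<times> V"
  let ?d = "\<lambda>(a, b, c). det2 (b - a) (c - a)"
  have "V \<noteq> {}" using assms(2) by auto
  then have T: "finite ?T" "?T \<noteq> {}" using assms(1) by auto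
  define d where "d = ?d"
  obtain p where "is_arg_min (\<lambda>q. - d q) (\<lambda>q. q \<in> ?T) p"
    using ex_is_arg_min_if_finite[OF T] by blast
  then have p: "p \<in> ?T" "\<And>q. q \<in> ?T \<Longrightarrow> d q \<le> d p"
    unfolding is_arg_min_linorder by (blast, metis neg_le_iff_le)
  obtain a b c where abc: "p = (a, b, c)" by (cases p)
  have V: "a \<in> V" "b \<in> V" "c \<in> V" using p(1) unfolding abc by blast+
  have max: "det2 (y - x) (z - x) \<le> det2 (b - a) (c - a)"
    if "x \<in> V" "y \<in> V" "z \<in> V" for x y z
    using p(2)[of "(x, y, z)"] that by (simp add: abc d_def)
  have "\<not> collinear V" using assms(2) by (simp add: collinear_aff_dim)
  then obtain x y z where xyz: "x \<in> V" "y \<in> V" "z \<in> V" "det2 (y - x) (z - x) \<noteq> 0"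
    using det2_eq_0_imp_collinear by blast
  \<comment> \<open>One of the two orientations of a nondegenerate triangle has positive
    determinant, hence so has the maximum.\<close>
  have "det2 (z - x) (y - x) = - det2 (y - x) (z - x)"
    by (simp add: det2_def)
  with xyz max[of x y z] max[of x z y]
  have pos: "det2 (b - a) (c - a) > 0" by linarith
  let ?D = "det2 (b - a) (c - a)"
  \<comment> \<open>Replace one vertex of the maximal triangle by \<open>v\<close>, in both
    orientations, to bound the absolute values.\<close>
  have s: "\<bar>det2 (v - a) (c - a)\<bar> \<le> ?D" "\<bar>det2 (b - a) (v - a)\<bar> \<le> ?D" if "v \<in> V" for v
  proof -
    have "det2 (c - a) (v - a) = - det2 (v - a) (c - a)" "det2 (v - a) (b - a) = - det2 (b - a) (v - a)"
      by (simp_all add: det2_def)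
    then show "\<bar>det2 (v - a) (c - a)\<bar> \<le> ?D" "\<bar>det2 (b - a) (v - a)\<bar> \<le> ?D"
      using max[OF V(1) that V(3)] max[OF V(1,3) that] max[OF V(1,2) that] max[OF V(1) that V(2)]
      by linarith+
  qed
  \<comment> \<open>Both determinants are affine in \<open>v\<close>, so this set is convex and the
    bounds pass from the vertices to their hull.\<close>
  let ?C = "{v. \<bar>det2 (v - a) (c - a)\<bar> \<le> ?D} \<inter> {v. \<bar>det2 (b - a) (v - a)\<bar> \<le> ?D}"
  have aff: "det2 ((u *\<^sub>R x + w *\<^sub>R y) - a) e = u * det2 (x - a) e + w * det2 (y - a) e"
    "det2 e ((u *\<^sub>R x + w *\<^sub>R y) - a) = u * det2 e (x - a) + w * det2 e (y - a)"
    if "u + w = 1" for u w x y e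
  proof -
    have w: "w = 1 - u" using that by simp
    show "det2 ((u *\<^sub>R x + w *\<^sub>R y) - a) e = u * det2 (x - a) e + w * det2 (y - a) e"
      "det2 e ((u *\<^sub>R x + w *\<^sub>R y) - a) = u * det2 e (x - a) + w * det2 e (y - a)"
      unfolding w by (simp_all add: det2_def algebra_simps)
  qed
  have cvx: "\<bar>u * p + w * q\<bar> \<le> D" if "\<bar>p\<bar> \<le> D" "\<bar>q\<bar> \<le> D" "u \<ge> 0" "w \<ge> 0" "u + w = 1" for u w p q D :: real
  proof -
    have "\<bar>u * p + w * q\<bar> \<le> u * \<bar>p\<bar> + w * \<bar>q\<bar>"
      using that(3,4) abs_triangle_ineq[of "u * p" "w * q"] by (simp add: abs_mult)
    also have "\<dots> \<le> u * D + w * D" using that by (intro add_mono mult_left_mono) auto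
    also have "\<dots> = D" using that(5) by (metis distrib_right mult_1)
    finally show ?thesis .
  qed
  have "convex ?C"
    unfolding convex_def by (simp add: aff cvx)
  moreover have "V \<subseteq> ?C" using s by blast
  ultimately have C: "convex hull V \<subseteq> ?C" by (rule hull_minimal[rotated])
  show thesis
  proof (rule that[OF V pos])
    fix v assume "v \<in> convex hull V"
    then have "\<bar>det2 (v - a) (c - a) / ?D\<bar> \<le> 1" "\<bar>det2 (b - a) (v - a) / ?D\<bar> \<le> 1"
      using C pos by auto
    then show "\<exists>s t. v = frame a b c s t \<and> \<bar>s\<bar> \<le> 1 \<and> \<bar>t\<bar> \<le> 1"
      using frame_cramer[of b a c v] pos by fastforce
  qed
qed

section \<open>A finite grid in frame coordinates\<close>

definition grid_frame :: "real^2 \<Rightarrow> real^2 \<Rightarrow> real^2 \<Rightarrow> int \<times> int \<Rightarrow> real^2" where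
  "grid_frame a b c g = frame a b c (of_int (fst g) / 200) (of_int (snd g) / 200)"

text \<open>For a coordinate in [-1, 1], scaling by 200 and taking the floor gives at most 200; the
  bound 201 leaves room for the upper neighbour.\<close>

definition grid :: "(int \<times> int) set" where
  "grid = {-201..201} \<times> {-201..201}"

lemma frame_convex_comb:
  assumes "u + w = 1"
  shows "u *\<^sub>R frame a b c s t + w *\<^sub>R frame a b c s' t' = frame a b c (u * s + w * s') (u * t + w * t')"
proof -
  have w: "w = 1 - u" using assms by simp
  show ?thesis unfolding w frame_def by (simp add: algebra_simps)
qed

text \<open>The barycentric coordinates 1 - s - t, s and t are all positive.\<close>

lemma frame_mem_interior_triangle:
  assumes "det2 (b - a) (c - a) > 0" "s > 0" "t > 0" "s + t < 1"
  shows "frame a b c s t \<in> interior (convex hull {a, b, c})"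
proof -
  have "\<not> collinear {a, b, c}" using collinear_imp_det2_eq_0[of a b c] assms(1) by auto
  then have "interior (convex hull {a, b, c}) =
      {v. \<exists>x y z. 0 < x \<and> 0 < y \<and> 0 < z \<and> x + y + z = 1 \<and> x *\<^sub>R a + y *\<^sub>R b + z *\<^sub>R c = v}"
    by (rule interior_convex_hull_3_minimal) (simp add: DIM_cart)
  moreover have "frame a b c s t = (1 - s - t) *\<^sub>R a + s *\<^sub>R b + t *\<^sub>R c"
    by (simp add: frame_def algebra_simps)
  moreover have "1 - s - t > 0" "(1 - s - t) + s + t = 1" using assms(4) by auto
  ultimately show ?thesis
    using assms(2,3)
    by (simp only: mem_Collect_eq) (rule exI, rule exI, rule exI, intro conjI, assumption+, rule refl)
qed

text \<open>Bilinear interpolation: first along the two horizontal edges of the cell, then between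
  them.\<close>

lemma mem_hull_grid_cell:
  assumes i: "of_int i / 200 \<le> s" "s \<le> (of_int i + 1) / 200"
    and j: "of_int j / 200 \<le> t" "t \<le> (of_int j + 1) / 200"
  shows "frame a b c s t \<in> convex hull (grid_frame a b c ` {(i, j), (i + 1, j), (i, j + 1), (i + 1, j + 1)})"
    (is "_ \<in> ?H")
proof -
  define u where "u = 200 * s - of_int i"
  define w where "w = 200 * t - of_int j"
  have uw: "0 \<le> u" "u \<le> 1" "0 \<le> w" "w \<le> 1" using i j by (auto simp: u_def w_def)
  have cv: "convex ?H" by simp
  have row: "frame a b c s (of_int k / 200) \<in> ?H" if "k = j \<or> k = j + 1" for k
  proof -
    have "(1 - u) *\<^sub>R grid_frame a b c (i, k) + u *\<^sub>R grid_frame a b c (i + 1, k) \<in> ?H"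
      using that uw by (intro convexD[OF cv] hull_inc) auto
    moreover have "(1 - u) * (of_int i / 200) + u * (of_int (i + 1) / 200) = s"
      by (simp add: u_def field_simps)
    moreover have "(1 - u) * (of_int k / 200) + u * (of_int k / 200) = of_int k / (200 :: real)"
      by (simp add: field_simps)
    moreover have "(1 - u) *\<^sub>R grid_frame a b c (i, k) + u *\<^sub>R grid_frame a b c (i + 1, k)
      = frame a b c ((1 - u) * (of_int i / 200) + u * (of_int (i + 1) / 200))
                    ((1 - u) * (of_int k / 200) + u * (of_int k / 200))"
      unfolding grid_frame_def fst_conv snd_conv by (rule frame_convex_comb) simp
    ultimately show ?thesis by (simp only:)
  qed
  have "(1 - w) *\<^sub>R frame a b c s (of_int j / 200) + w *\<^sub>R frame a b c s (of_int (j + 1) / 200) \<in> ?H"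
    using uw by (intro convexD[OF cv] row) auto
  moreover have "(1 - w) * (of_int j / 200) + w * (of_int (j + 1) / 200) = t"
    by (simp add: w_def field_simps)
  moreover have "(1 - w) * s + w * s = s" by (simp add: algebra_simps)
  moreover have "(1 - w) *\<^sub>R frame a b c s (of_int j / 200) + w *\<^sub>R frame a b c s (of_int (j + 1) / 200)
      = frame a b c ((1 - w) * s + w * s) ((1 - w) * (of_int j / 200) + w * (of_int (j + 1) / 200))"
    by (rule frame_convex_comb) simp
  ultimately show ?thesis by (simp only:)
qed

text \<open>Contracting by 19/20 towards the centroid leaves room for perturbing the frame coordinates by
  less than (1/20) (1/6), the supremum-norm inradius of the standard triangle at its centroid
  being 1/6; this exceeds the mesh 1/200 of the grid.\<close>

lemma grid_point_in_interior:
  assumes "convex Q" "a \<in> Q" "b \<in> Q" "c \<in> Q" "det2 (b - a) (c - a) > 0"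
    and q: "frame a b c s t \<in> Q"
    and s: "\<bar>s' - (19/20 * s + 1/60)\<bar> \<le> 1/200" and t: "\<bar>t' - (19/20 * t + 1/60)\<bar> \<le> 1/200"
  shows "frame a b c s' t' \<in> interior Q"
proof -
  \<comment> \<open>These solve s' = 19/20 s + 1/20 x and t' = 19/20 t + 1/20 y. Both differ from
    1/3 by at most 20/200 = 1/10, so (x, y) stays inside the standard triangle.\<close>
  define x where "x = 20 * s' - 19 * s"
  define y where "y = 20 * t' - 19 * t"
  have "x > 0" "y > 0" "x + y < 1"
    using s t unfolding x_def y_def by linarith+
  then have "frame a b c x y \<in> interior (convex hull {a, b, c})"
    using assms(5) by (intro frame_mem_interior_triangle)
  moreover have "convex hull {a, b, c} \<subseteq> Q" using assms by (intro hull_minimal) auto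
  ultimately have "frame a b c x y \<in> interior Q" using interior_mono by blast
  \<comment> \<open>Moving from a point of a convex set part of the way towards an interior point
    leads into the interior.\<close>
  then have "frame a b c s t - (1/20) *\<^sub>R (frame a b c s t - frame a b c x y) \<in> interior Q"
    using assms(1) q by (intro mem_interior_convex_shrink) auto
  moreover have "frame a b c s t - (1/20) *\<^sub>R (frame a b c s t - frame a b c x y)
      = (19/20) *\<^sub>R frame a b c s t + (1/20) *\<^sub>R frame a b c x y"
    by (simp add: algebra_simps flip: scaleR_add_left)
  moreover have "\<dots> = frame a b c s' t'"
  proof -
    have "19/20 * s + 1/20 * x = s'" "19/20 * t + 1/20 * y = t'"
      by (simp_all add: x_def y_def field_simps)
    with frame_convex_comb[of "19/20" "1/20" a b c s t x y] show ?thesis by simp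
  qed
  ultimately show ?thesis by simp
qed

lemma measure_lebesgue_homothety:
  fixes S :: "(real^2) set"
  shows "measure lebesgue ((\<lambda>x. r *\<^sub>R x + v) ` S) = r\<^sup>2 * measure lebesgue S"
  by (simp add: measure_lebesgue_affine)

text \<open>Contracting \<open>Q\<close> by 19/20 towards the centroid of its largest vertex
  triangle puts each point in a grid cell whose corners are interior to \<open>Q\<close>. The hull
  of the interior grid points therefore contains the contracted copy, of relative area 361/400. It
  is determined by three vertices and one of finitely many sets \<open>J\<close>, however many
  vertices \<open>Q\<close> has.\<close>

lemma polygon_inner_approximation:
  assumes "convex_polygon Q"
  obtains a b c J where "a \<in> vertices Q" "b \<in> vertices Q" "c \<in> vertices Q" "J \<subseteq> grid"
    and "convex hull (grid_frame a b c ` J) \<subseteq> interior Q"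
    and "measure lebesgue (convex hull (grid_frame a b c ` J)) \<ge> 361/400 * measure lebesgue Q"
proof -
  have Q: "polytope Q" "aff_dim Q = 2" using assms by (auto simp: convex_polygon_def)
  have cvx: "convex Q" using Q(1) by (rule polytope_imp_convex)
  have hull: "Q = convex hull (vertices Q)"
    unfolding vertices_def using Q(1)
    by (intro Krein_Milman_Minkowski polytope_imp_compact polytope_imp_convex)
  have fin: "finite (vertices Q)"
    using finite_polyhedron_extreme_points[of Q] Q(1) polytope_imp_polyhedron by (auto simp: vertices_def)
  have "aff_dim (vertices Q) = 2" using Q(2) hull by (metis aff_dim_convex_hull)
  from largest_triangle[OF fin this] obtain a b c where
    V: "a \<in> vertices Q" "b \<in> vertices Q" "c \<in> vertices Q" and pos: "det2 (b - a) (c - a) > 0"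
    and box: "\<And>v. v \<in> Q \<Longrightarrow> \<exists>s t. v = frame a b c s t \<and> \<bar>s\<bar> \<le> 1 \<and> \<bar>t\<bar> \<le> 1"
    using hull by metis
  have VQ: "a \<in> Q" "b \<in> Q" "c \<in> Q" using V hull by (auto intro: hull_inc simp: vertices_def extreme_point_of_def)
  define J where "J = {g \<in> grid. grid_frame a b c g \<in> interior Q}"
  let ?S = "convex hull (grid_frame a b c ` J)"
  have int: "?S \<subseteq> interior Q"
    using cvx by (intro hull_minimal convex_interior) (auto simp: J_def)
  define p where "p = frame a b c (1/3) (1/3)"
  have sub: "(\<lambda>x. (19/20) *\<^sub>R x + (1/20) *\<^sub>R p) ` Q \<subseteq> ?S"
  proof (rule image_subsetI)
    fix q assume q: "q \<in> Q"
    obtain s t where st: "q = frame a b c s t" "\<bar>s\<bar> \<le> 1" "\<bar>t\<bar> \<le> 1" using box[OF q] by blast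
    \<comment> \<open>The contracted point has these frame coordinates; 1/60 is 1/20 of the centroid
      coordinate 1/3.\<close>
    define s' where "s' = 19/20 * s + 1/60"
    define t' where "t' = 19/20 * t + 1/60"
    define i where "i = \<lfloor>200 * s'\<rfloor>"
    define j where "j = \<lfloor>200 * t'\<rfloor>"
    have eq: "(19/20) *\<^sub>R q + (1/20) *\<^sub>R p = frame a b c s' t'"
    proof -
      have "19/20 * s + 1/20 * (1/3) = s'" "19/20 * t + 1/20 * (1/3) = t'"
        by (simp_all add: s'_def t'_def)
      with frame_convex_comb[of "19/20" "1/20" a b c s t "1/3" "1/3"] show ?thesis
        unfolding st(1) p_def by simp
    qed
    have ij: "of_int i \<le> 200 * s'" "200 * s' < of_int i + 1" "of_int j \<le> 200 * t'" "200 * t' < of_int j + 1"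
      unfolding i_def j_def by linarith+
    have "\<bar>s'\<bar> \<le> 1" "\<bar>t'\<bar> \<le> 1" using st(2,3) by (auto simp: s'_def t'_def abs_le_iff)
    then have "real_of_int i \<le> 200" "real_of_int i > -202" "real_of_int j \<le> 200" "real_of_int j > -202"
      using ij by (auto simp: abs_le_iff)
    then have bnd: "i \<le> 200" "i > -202" "j \<le> 200" "j > -202" by linarith+
    have "{(i, j), (i + 1, j), (i, j + 1), (i + 1, j + 1)} \<subseteq> J"
    proof
      fix g assume g: "g \<in> {(i, j), (i + 1, j), (i, j + 1), (i + 1, j + 1)}"
      then have "g \<in> grid" using bnd by (auto simp: grid_def)
      moreover have "\<bar>of_int (fst g) / 200 - s'\<bar> \<le> 1/200" "\<bar>of_int (snd g) / 200 - t'\<bar> \<le> 1/200"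
      proof -
        have "real_of_int (fst g) = of_int i \<or> real_of_int (fst g) = of_int i + 1"
          and "real_of_int (snd g) = of_int j \<or> real_of_int (snd g) = of_int j + 1"
          using g by auto
        then show "\<bar>of_int (fst g) / 200 - s'\<bar> \<le> 1/200" "\<bar>of_int (snd g) / 200 - t'\<bar> \<le> 1/200"
          using ij by linarith+
      qed
      then have "grid_frame a b c g \<in> interior Q"
        unfolding grid_frame_def s'_def t'_def using q st(1)
        by (intro grid_point_in_interior[OF cvx VQ pos]) auto
      ultimately show "g \<in> J" by (simp add: J_def)
    qed
    then have "convex hull (grid_frame a b c ` {(i, j), (i + 1, j), (i, j + 1), (i + 1, j + 1)}) \<subseteq> ?S"
      by (intro hull_mono image_mono)
    moreover have "frame a b c s' t' \<in> convex hull (grid_frame a b c ` {(i, j), (i + 1, j), (i, j + 1), (i + 1, j + 1)})"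
      using ij by (intro mem_hull_grid_cell) auto
    ultimately show "(19/20) *\<^sub>R q + (1/20) *\<^sub>R p \<in> ?S" unfolding eq by blast
  qed
  have "finite J" by (rule finite_subset[of _ grid]) (auto simp: J_def grid_def)
  then have S: "?S \<in> lmeasurable"
    by (intro lmeasurable_compact finite_imp_compact_convex_hull finite_imageI)
  have Qm: "Q \<in> sets lebesgue" 
    using Q(1) by (intro fmeasurableD lmeasurable_compact polytope_imp_compact)
  have "361/400 * measure lebesgue Q = measure lebesgue ((\<lambda>x. (19/20) *\<^sub>R x + (1/20) *\<^sub>R p) ` Q)"
    by (simp add: measure_lebesgue_homothety power2_eq_square)
  also have "\<dots> \<le> measure lebesgue ?S"
  proof (rule measure_mono_fmeasurable[OF sub _ S])
    have "compact ((\<lambda>x. (19/20) *\<^sub>R x + (1/20) *\<^sub>R p) ` Q)"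
      using Q(1) by (intro compact_continuous_image continuous_intros polytope_imp_compact)
    then show "(\<lambda>x. (19/20) *\<^sub>R x + (1/20) *\<^sub>R p) ` Q \<in> sets lebesgue"
      by (intro fmeasurableD lmeasurable_compact)
  qed
  finally show thesis
    using that[OF V _ int] by (simp add: J_def)
qed

section \<open>Random points missing a set\<close>

lemma sets_uniform_lebesgue: "sets (uniform_measure lebesgue K) = sets lebesgue"
  by (simp add: uniform_measure_def)

lemma space_uniform_lebesgue: "space (uniform_measure lebesgue K) = UNIV"
  by (simp add: uniform_measure_def)

text \<open>A nonmeasurable set has \<open>measure\<close> 0 by convention, so area 1 implies
  measurability.\<close>

lemma unit_area_sets:
  assumes "measure lebesgue K = 1"
  shows "K \<in> sets lebesgue"
  using assms measure_notin_sets[of K lebesgue] by fastforce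

lemma unit_area_emeasure:
  assumes "measure lebesgue K = 1"
  shows "emeasure lebesgue K = 1"
  using assms emeasure_eq_ennreal_measure[of lebesgue K] by (cases "emeasure lebesgue K = \<top>") (auto simp: measure_def)

lemma prob_space_uniform_lebesgue:
  assumes "measure lebesgue K = 1"
  shows "prob_space (uniform_measure lebesgue K)"
  using unit_area_emeasure[OF assms] by (intro prob_space_uniform_measure) auto

lemma measure_uniform_lebesgue:
  assumes "measure lebesgue K = 1" "S \<subseteq> K" "S \<in> sets lebesgue"
  shows "measure (uniform_measure lebesgue K) S = measure lebesgue S"
proof -
  have "K \<inter> S = S" using assms(2) by blast
  then have "emeasure (uniform_measure lebesgue K) S = emeasure lebesgue S"
    using assms unit_area_sets[OF assms(1)] unit_area_emeasure[OF assms(1)]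
    by (simp add: divide_ennreal_def)
  then show ?thesis by (simp only: measure_def)
qed

lemma avoid_in_sets:
  assumes "S \<in> sets M" "finite J"
  shows "{x \<in> space (PiM J (\<lambda>_. M)). \<forall>l\<in>J. x l \<notin> S} \<in> sets (PiM J (\<lambda>_. M))"
  using assms
  by (intro predE pred_intros_finite pred_intros_logic pred_sets2[OF assms(1)] measurable_component_singleton)

lemma prob_avoid:
  assumes "prob_space M" "S \<in> sets M" "finite J"
  shows "measure (PiM J (\<lambda>_. M)) {x \<in> space (PiM J (\<lambda>_. M)). \<forall>l\<in>J. x l \<notin> S}
    = (1 - measure M S) ^ card J"
proof -
  interpret M: prob_space M by fact
  interpret P: finite_product_prob_space "\<lambda>_. M" J by unfold_locales fact
  have "{x \<in> space (PiM J (\<lambda>_. M)). \<forall>l\<in>J. x l \<notin> S} = Pi\<^sub>E J (\<lambda>_. space M - S)"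
    by (auto simp: space_PiM PiE_iff extensional_def)
  then show ?thesis
    using assms(2) by (simp add: P.prob_times M.prob_compl)
qed

text \<open>The set \<open>S x\<close> depends only on the coordinates in \<open>T\<close>. Once
  these are fixed, the other points are still independent and each misses a fixed set of measure at
  least \<open>t\<close>; Fubini integrates this conditional bound.\<close>

lemma prob_avoid_dependent:
  fixes S :: "('i \<Rightarrow> 'a) \<Rightarrow> 'a set"
  assumes "prob_space M" and I: "finite I" "T \<subseteq> I" and t: "t \<le> 1"
    and S: "\<And>x. S x \<in> sets M" "\<And>x y. (\<And>i. i \<in> T \<Longrightarrow> x i = y i) \<Longrightarrow> S x = S y"
    and E: "E = {x \<in> space (PiM I (\<lambda>_. M)). t \<le> measure M (S x) \<and> (\<forall>l\<in>I - T. x l \<notin> S x)}"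
      "E \<in> sets (PiM I (\<lambda>_. M))"
  shows "measure (PiM I (\<lambda>_. M)) E \<le> (1 - t) ^ (card I - card T)"
proof -
  interpret M: prob_space M by fact
  interpret P: product_prob_space "\<lambda>_. M" I by unfold_locales
  interpret PT: prob_space "PiM T (\<lambda>_. M)" by (rule prob_space_PiM) (rule assms(1))
  define J where "J = I - T"
  have J: "T \<inter> J = {}" "finite T" "finite J" "T \<union> J = I"
    using I finite_subset by (auto simp: J_def)
  interpret PJ: prob_space "PiM J (\<lambda>_. M)" by (rule prob_space_PiM) (rule assms(1))
  have card: "card J = card I - card T"
    using I J unfolding J_def by (simp add: card_Diff_subset)
  have inner: "(\<integral>\<^sup>+ y. indicator E (merge T J (x, y)) \<partial>PiM J (\<lambda>_. M)) \<le> ennreal ((1 - t) ^ card J)" for x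
  proof (cases "t \<le> measure M (S x)")
    case True
    have Sx: "S (merge T J (x, y)) = S x" for y
      by (rule S(2)) (use J(1) in \<open>simp add: merge_def\<close>)
    let ?A = "{y \<in> space (PiM J (\<lambda>_. M)). \<forall>l\<in>J. y l \<notin> S x}"
    have "(\<integral>\<^sup>+ y. indicator E (merge T J (x, y)) \<partial>PiM J (\<lambda>_. M)) \<le> (\<integral>\<^sup>+ y. indicator ?A y \<partial>PiM J (\<lambda>_. M))"
    proof (rule nn_integral_mono)
      fix y assume y: "y \<in> space (PiM J (\<lambda>_. M))"
      show "indicator E (merge T J (x, y)) \<le> (indicator ?A y :: ennreal)"
      proof (cases "merge T J (x, y) \<in> E")
        case True
        then have "\<forall>l\<in>J. merge T J (x, y) l \<notin> S (merge T J (x, y))"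
          unfolding E(1) J_def by blast
        then have *: "merge T J (x, y) l \<notin> S x" if "l \<in> J" for l
          using that unfolding Sx by blast
        have "merge T J (x, y) l = y l" if "l \<in> J" for l
          using that J(1) by (auto simp: merge_def)
        with * have "y \<in> ?A" using y by fastforce
        then show ?thesis using True by (simp only: indicator_simps order_refl)
      qed simp
    qed
    also have "\<dots> = emeasure (PiM J (\<lambda>_. M)) ?A"
      by (intro nn_integral_indicator avoid_in_sets S J(3))
    also have "\<dots> = ennreal ((1 - measure M (S x)) ^ card J)"
      using prob_avoid[OF assms(1) S(1) J(3)] by (simp only: PJ.emeasure_eq_measure)
    also have "\<dots> \<le> ennreal ((1 - t) ^ card J)"
      using True t by (intro ennreal_leI power_mono) auto
    finally show ?thesis .
  \<comment> \<open>If the set is too small, the section of \<open>E\<close> is empty, since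
    \<open>E\<close> includes the lower bound \<open>t\<close>.\<close>
  next
    case False
    have "merge T J (x, y) \<notin> E" for y
    proof -
      have "S (merge T J (x, y)) = S x"
        by (rule S(2)) (use J(1) in \<open>simp add: merge_def\<close>)
      with False show ?thesis unfolding E(1) by simp
    qed
    then show ?thesis by simp
  qed
  have "emeasure (PiM I (\<lambda>_. M)) E = (\<integral>\<^sup>+ x. indicator E x \<partial>PiM (T \<union> J) (\<lambda>_. M))"
    using E(2) J(4) by simp
  also have "\<dots> = (\<integral>\<^sup>+ x. (\<integral>\<^sup>+ y. indicator E (merge T J (x, y)) \<partial>PiM J (\<lambda>_. M)) \<partial>PiM T (\<lambda>_. M))"
    using E(2) J by (intro P.product_nn_integral_fold) simp_all
  also have "\<dots> \<le> (\<integral>\<^sup>+ x. ennreal ((1 - t) ^ card J) \<partial>PiM T (\<lambda>_. M))"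
    by (intro nn_integral_mono inner)
  also have "\<dots> = ennreal ((1 - t) ^ card J)"
    by (simp add: PT.emeasure_space_1)
  finally show ?thesis
    using t unfolding card by (simp add: measure_def enn2real_leI)
qed

section \<open>Union bound for large holes\<close>

lemma finite_grid: "finite grid"
  by (simp add: grid_def)

lemma borel_measurable_grid_frame:
  assumes "a \<in> borel_measurable M" "b \<in> borel_measurable M" "c \<in> borel_measurable M"
  shows "(\<lambda>x. grid_frame (a x) (b x) (c x) g) \<in> borel_measurable M"
  unfolding grid_frame_def frame_def using assms by measurable

text \<open>A hole of area above \<open>r\<close> yields a triple of indices and a grid subset whose
  hull has measure at least 361/400 r and contains none of the points. The bound sums over n^3
  triples and all subsets of \<open>grid\<close>.\<close>

lemma prob_PolyMax_greater:
  assumes "convex K" "measure lebesgue K = 1" and r: "r \<ge> 0" "361/400 * r \<le> 1"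
  shows "measure (uniform_points K n) {x \<in> space (uniform_points K n). r < PolyMax K (x ` {..<n})}
    \<le> real n ^ 3 * real (card (Pow grid)) * (1 - 361/400 * r) ^ (n - 3)"
proof -
  let ?M = "uniform_measure lebesgue K"
  let ?U = "uniform_points K n"
  let ?t = "361/400 * r"
  interpret M: prob_space ?M using assms(2) by (rule prob_space_uniform_lebesgue)
  interpret U: prob_space ?U
    unfolding uniform_points_def by (intro prob_space_PiM M.prob_space_axioms)
  define S where "S i j k J x = convex hull ((\<lambda>g. grid_frame (x i) (x j) (x k) g) ` J)"
    for i j k :: nat and J and x :: "nat \<Rightarrow> real^2"
  define E where "E i j k J = {x \<in> space ?U. ?t \<le> measure ?M (S i j k J x) \<and>
      (\<forall>l\<in>{..<n} - {i, j, k}. x l \<notin> S i j k J x)}" for i j k J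
  define I where "I = ({..<n} \<times> {..<n} \<times> {..<n}) \<times> Pow grid"
  have Jfin: "finite J" if "J \<subseteq> grid" for J using that finite_grid by (rule finite_subset)
  have E_sets: "E i j k J \<in> sets ?U" if "i < n" "j < n" "k < n" "J \<subseteq> grid" for i j k J
  proof -
    have f: "(\<lambda>x. grid_frame (x i) (x j) (x k) g) \<in> borel_measurable ?U" for g
      using that by (intro borel_measurable_grid_frame uniform_points_component(2))
    have "(\<lambda>x. emeasure ?M (S i j k J x)) \<in> borel_measurable ?U"
      unfolding S_def
    proof (rule measurable_emeasure_convex_hull[OF Jfin[OF that(4)]])
      show "(\<lambda>x. grid_frame (x i) (x j) (x k) g) \<in> borel_measurable ?U" for g by (rule f)
      show "(\<lambda>y. y) \<in> borel_measurable ?M"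
        by (subst measurable_cong_sets[OF sets_uniform_lebesgue refl]) (rule measurable_completion, simp)
    qed (rule M.sigma_finite_measure_axioms, rule space_uniform_lebesgue)
    then have "(\<lambda>x. measure ?M (S i j k J x)) \<in> borel_measurable ?U"
      unfolding measure_def by (rule measurable_compose) simp
    then have "Measurable.pred ?U (\<lambda>x. ?t \<le> measure ?M (S i j k J x))"
      unfolding pred_def by (rule borel_measurable_le[OF borel_measurable_const])
    moreover have "Measurable.pred ?U (\<lambda>x. x l \<in> S i j k J x)" if "l < n" for l
      unfolding S_def
      by (rule pred_mem_convex_hull[OF Jfin[OF \<open>J \<subseteq> grid\<close>] f uniform_points_component(2)[OF that]])
    ultimately show ?thesis
      unfolding E_def by (intro predE pred_intros_logic pred_intros_finite) simp_all
  qed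
  have E_prob: "measure ?U (E i j k J) \<le> (1 - ?t) ^ (n - 3)"
    if "i < n" "j < n" "k < n" "J \<subseteq> grid" for i j k J
  proof -
    have "measure ?U (E i j k J) \<le> (1 - ?t) ^ (card {..<n} - card {i, j, k})"
      unfolding uniform_points_def
    proof (rule prob_avoid_dependent[where S="S i j k J"])
      show "S i j k J x \<in> sets ?M" for x
        unfolding S_def sets_uniform_lebesgue using Jfin[OF that(4)]
        by (intro fmeasurableD lmeasurable_compact finite_imp_compact_convex_hull finite_imageI)
      show "S i j k J x = S i j k J y" if "\<And>l. l \<in> {i, j, k} \<Longrightarrow> x l = y l" for x y
        using that unfolding S_def by simp
    qed (use that r E_sets[OF that] M.prob_space_axioms in \<open>simp_all add: E_def uniform_points_def\<close>)
    also have "\<dots> \<le> (1 - ?t) ^ (n - 3)"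
    proof (rule power_decreasing)
      \<comment> \<open>Coinciding indices only leave more points that must miss the hull.\<close>
      have "card {i, j, k} \<le> 3" using card_length[of "[i, j, k]"] by simp
      then show "n - 3 \<le> card {..<n} - card {i, j, k}" by simp
    qed (use r in simp_all)
    finally show ?thesis .
  qed
  have sub: "{x \<in> space ?U. r < PolyMax K (x ` {..<n})} \<subseteq> (\<Union>((i, j, k), J)\<in>I. E i j k J)"
  proof
    fix x assume "x \<in> {x \<in> space ?U. r < PolyMax K (x ` {..<n})}"
    then have x: "x \<in> space ?U" "r < PolyMax K (x ` {..<n})" by auto
    let ?P = "x ` {..<n}"
    have "PolyMax K ?P \<in> insert 0 (measure lebesgue ` polygonal_holes K ?P)"
      unfolding PolyMax_def by (rule Max_in) (simp_all add: finite_polygonal_holes)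
    \<comment> \<open>Since \<open>r\<close> is nonnegative, the default value 0 is excluded and the
      maximum is the area of an actual hole.\<close>
    moreover have "PolyMax K ?P \<noteq> 0" using x(2) r(1) by linarith
    ultimately obtain Q where Q: "Q \<in> polygonal_holes K ?P" "PolyMax K ?P = measure lebesgue Q" by blast
    then have Q': "convex_polygon Q" "vertices Q \<subseteq> ?P" "Q \<subseteq> K" "interior Q \<inter> ?P = {}"
      by (auto simp: polygonal_holes_def hole_def)
    obtain a b c J where abc: "a \<in> vertices Q" "b \<in> vertices Q" "c \<in> vertices Q" "J \<subseteq> grid"
      and J: "convex hull (grid_frame a b c ` J) \<subseteq> interior Q"
        "measure lebesgue (convex hull (grid_frame a b c ` J)) \<ge> 361/400 * measure lebesgue Q"
      by (rule polygon_inner_approximation[OF Q'(1)])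
    have "a \<in> ?P" "b \<in> ?P" "c \<in> ?P" using abc(1-3) Q'(2) by blast+
    then obtain i j k where ijk: "i < n" "a = x i" "j < n" "b = x j" "k < n" "c = x k"
      by blast
    have SJ: "S i j k J x = convex hull (grid_frame a b c ` J)" by (simp add: S_def ijk)
    have "S i j k J x \<in> sets lebesgue"
      unfolding S_def using Jfin[OF abc(4)]
      by (intro fmeasurableD lmeasurable_compact finite_imp_compact_convex_hull finite_imageI)
    \<comment> \<open>Inside \<open>K\<close> the uniform measure agrees with area.\<close>
    moreover have "S i j k J x \<subseteq> K" using J(1) Q'(3) interior_subset unfolding SJ by blast
    ultimately have "measure ?M (S i j k J x) = measure lebesgue (S i j k J x)"
      by (intro measure_uniform_lebesgue assms(2))
    then have "?t \<le> measure ?M (S i j k J x)"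
      using J(2) Q(2) x(2) unfolding SJ by linarith
    moreover have "x l \<notin> S i j k J x" if "l < n" for l
      using J(1) Q'(4) that unfolding SJ by blast
    ultimately have "x \<in> E i j k J" using x(1) unfolding E_def by simp
    then show "x \<in> (\<Union>((i, j, k), J)\<in>I. E i j k J)"
      using ijk abc(4) unfolding I_def by auto
  qed
  have Ifin: "finite I" unfolding I_def using finite_grid by simp
  have "measure ?U {x \<in> space ?U. r < PolyMax K (x ` {..<n})} \<le> measure ?U (\<Union>((i, j, k), J)\<in>I. E i j k J)"
    using Ifin E_sets by (intro U.finite_measure_mono[OF sub] sets.finite_UN) (auto simp: I_def)
  also have "\<dots> \<le> (\<Sum>((i, j, k), J)\<in>I. measure ?U (E i j k J))"
    using U.finite_measure_subadditive_finite[OF Ifin, of "\<lambda>((i, j, k), J). E i j k J"] E_sets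
    by (fastforce simp: I_def case_prod_unfold)
  also have "\<dots> \<le> (\<Sum>((i, j, k), J)\<in>I. (1 - ?t) ^ (n - 3))"
    using E_prob by (intro sum_mono) (auto simp: I_def)
  also have "\<dots> = real (card I) * (1 - ?t) ^ (n - 3)"
    by (simp add: case_prod_unfold)
  also have "real (card I) = real n ^ 3 * real (card (Pow grid))"
    by (simp add: I_def card_cartesian_product power3_eq_cube)
  finally show ?thesis .
qed

section \<open>A hole from a square with hit corners\<close>

definition rect :: "real \<Rightarrow> real \<Rightarrow> real \<Rightarrow> real \<Rightarrow> (real^2) set" where
  "rect x x' y y' = {v. x < v $ 1 \<and> v $ 1 < x' \<and> y < v $ 2 \<and> v $ 2 < y'}"

lemma rect_eq_box: "rect x x' y y' = box (vector [x, y]) (vector [x', y'])"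
  by (auto simp: rect_def mem_box_cart forall_2)

lemma rect_lmeasurable: "rect x x' y y' \<in> lmeasurable"
  unfolding rect_eq_box by (rule lmeasurable_box)

lemma measure_rect:
  assumes "x \<le> x'" "y \<le> y'"
  shows "measure lebesgue (rect x x' y y') = (x' - x) * (y' - y)"
proof -
  have "cbox (vector [x, y]) (vector [x', y'] :: real^2) \<noteq> {}"
    using assms by (simp add: interval_ne_empty_cart forall_2)
  then have "measure lebesgue (cbox (vector [x, y]) (vector [x', y'] :: real^2)) = (x' - x) * (y' - y)"
    by (simp add: content_cbox_cart UNIV_2)
  then show ?thesis
    unfolding rect_eq_box by (simp add: measure_lborel_box_eq measure_lborel_cbox_eq)
qed

text \<open>The two booleans choose right over left and top over bottom; each choice gives an open
  square of side \<open>\<theta> * s\<close>.\<close>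

definition corner :: "real \<Rightarrow> real \<Rightarrow> real \<Rightarrow> real \<Rightarrow> bool \<times> bool \<Rightarrow> (real^2) set" where
  "corner \<theta> s x y \<sigma> =
     rect (if fst \<sigma> then x + (1 - \<theta>) * s else x) (if fst \<sigma> then x + s else x + \<theta> * s)
          (if snd \<sigma> then y + (1 - \<theta>) * s else y) (if snd \<sigma> then y + s else y + \<theta> * s)"

lemma measure_corner:
  assumes "0 < \<theta>" "\<theta> < 1" "s > 0"
  shows "measure lebesgue (corner \<theta> s x y \<sigma>) = (\<theta> * s)\<^sup>2"
  unfolding corner_def using assms
  by (subst measure_rect) (auto simp: power2_eq_square algebra_simps)

lemma corner_subset_cell:
  assumes "0 < \<theta>" "\<theta> < 1" "s > 0"
  shows "corner \<theta> s x y \<sigma> \<subseteq> rect x (x + s) y (y + s)"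
proof -
  define r where "r = \<theta> * s"
  have "0 < r" "r < s" "(1 - \<theta>) * s = s - r" using assms by (auto simp: r_def algebra_simps)
  then show ?thesis
    unfolding corner_def rect_def r_def[symmetric] by (cases "fst \<sigma>"; cases "snd \<sigma>") auto
qed

lemma inner_vec_2: "(u :: real^2) \<bullet> v = u $ 1 * v $ 1 + u $ 2 * v $ 2"
  by (simp add: inner_vec_def sum_2)

text \<open>The outward direction from the centre of a cell to the corner \<open>\<sigma>\<close>;
  small inner products within that corner mean points lying further in.\<close>

definition diagonal :: "bool \<times> bool \<Rightarrow> real^2" where
  "diagonal \<sigma> = vector [if fst \<sigma> then 1 else - 1, if snd \<sigma> then 1 else - 1]"

text \<open>Let r = \<open>\<theta> * s\<close> and measure from the opposite vertex of the cell
  along the diagonal direction. The corner \<open>\<sigma>\<close> starts at 2s - 2r while every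
  other corner ends by s + r, and 3r < s because \<open>\<theta> < 1/4\<close>.\<close>

lemma diagonal_corner_le:
  assumes "0 < \<theta>" "\<theta> < 1/4" "s > 0" "p \<in> corner \<theta> s x y \<sigma>" "q \<in> corner \<theta> s x y \<tau>" "\<tau> \<noteq> \<sigma>"
  shows "diagonal \<sigma> \<bullet> q \<le> diagonal \<sigma> \<bullet> p"
proof -
  obtain i j where \<sigma>: "\<sigma> = (i, j)" by (cases \<sigma>)
  obtain k l where \<tau>: "\<tau> = (k, l)" by (cases \<tau>)
  define r where "r = \<theta> * s"
  have r: "0 < r" "r < s / 4" "(1 - \<theta>) * s = s - r"
    using assms(1-3) by (auto simp: r_def algebra_simps)
  show ?thesis
    using assms(4-6) r(1,2) unfolding \<sigma> \<tau> corner_def rect_def diagonal_def inner_vec_2 r(3) r_def[symmetric]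
    by (cases i; cases j; cases k; cases l) auto
qed

text \<open>For each direction \<open>u\<close>, the corner selected by the signs of its coordinates
  lies at least as far out as the inner square in both coordinates, so no direction separates a
  point of that square from the hull.\<close>

lemma inner_square_subset_hull:
  assumes "\<And>\<sigma>. f \<sigma> \<in> corner \<theta> s x y \<sigma>"
  shows "rect (x + \<theta> * s) (x + (1 - \<theta>) * s) (y + \<theta> * s) (y + (1 - \<theta>) * s) \<subseteq> convex hull (range f)"
proof
  fix z assume z: "z \<in> rect (x + \<theta> * s) (x + (1 - \<theta>) * s) (y + \<theta> * s) (y + (1 - \<theta>) * s)"
  have "\<exists>v\<in>range f. u \<bullet> z \<le> u \<bullet> v" for u :: "real^2"
  proof -
    let ?\<sigma> = "(u $ 1 \<ge> 0, u $ 2 \<ge> 0)"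
    have "u $ 1 * z $ 1 \<le> u $ 1 * f ?\<sigma> $ 1"
    proof (cases "u $ 1 \<ge> 0")
      case True
      then show ?thesis using assms[of ?\<sigma>] z
        by (intro mult_left_mono) (auto simp: corner_def rect_def)
    next
      case False
      then show ?thesis using assms[of ?\<sigma>] z
        by (intro mult_left_mono_neg) (auto simp: corner_def rect_def)
    qed
    moreover have "u $ 2 * z $ 2 \<le> u $ 2 * f ?\<sigma> $ 2"
    proof (cases "u $ 2 \<ge> 0")
      case True
      then show ?thesis using assms[of ?\<sigma>] z
        by (intro mult_left_mono) (auto simp: corner_def rect_def)
    next
      case False
      then show ?thesis using assms[of ?\<sigma>] z
        by (intro mult_left_mono_neg) (auto simp: corner_def rect_def)
    qed
    ultimately have "u \<bullet> z \<le> u \<bullet> f ?\<sigma>" unfolding inner_vec_2 by linarith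
    then show ?thesis by blast
  qed
  moreover have "finite (range f)" by simp
  ultimately show "z \<in> convex hull (range f)"
    by (subst hull_mem_iff_dense[where D=UNIV]) auto
qed

text \<open>In each corner take the point that is extreme in the inward diagonal direction: any other point
  of that corner lies outside the interior of the hull of the four chosen points.\<close>

lemma PolyMax_ge_inner_square:
  assumes "finite P" "0 < \<theta>" "\<theta> < 1/4" "s > 0"
    and cell: "rect x (x + s) y (y + s) \<subseteq> K"
    and empty: "P \<inter> rect x (x + s) y (y + s) \<subseteq> (\<Union>\<sigma>. corner \<theta> s x y \<sigma>)"
    and hit: "\<And>\<sigma>. P \<inter> corner \<theta> s x y \<sigma> \<noteq> {}"
  shows "((1 - 2 * \<theta>) * s)\<^sup>2 \<le> PolyMax K P"
proof -
  have "\<exists>p. p \<in> P \<and> p \<in> corner \<theta> s x y \<sigma> \<and>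
      (\<forall>q. q \<in> P \<longrightarrow> q \<in> corner \<theta> s x y \<sigma> \<longrightarrow> diagonal \<sigma> \<bullet> p \<le> diagonal \<sigma> \<bullet> q)" for \<sigma>
  proof -
    have "finite (P \<inter> corner \<theta> s x y \<sigma>)" using assms(1) by blast
    from ex_is_arg_min_if_finite[OF this hit, of "\<lambda>p. diagonal \<sigma> \<bullet> p"]
    show ?thesis unfolding is_arg_min_linorder Int_iff by meson
  qed
  then obtain f where f': "\<And>\<sigma>. f \<sigma> \<in> P \<and> f \<sigma> \<in> corner \<theta> s x y \<sigma> \<and>
      (\<forall>q. q \<in> P \<longrightarrow> q \<in> corner \<theta> s x y \<sigma> \<longrightarrow> diagonal \<sigma> \<bullet> f \<sigma> \<le> diagonal \<sigma> \<bullet> q)"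
    by meson
  then have f: "\<And>\<sigma>. f \<sigma> \<in> P" "\<And>\<sigma>. f \<sigma> \<in> corner \<theta> s x y \<sigma>"
    and min: "\<And>\<sigma> q. q \<in> P \<Longrightarrow> q \<in> corner \<theta> s x y \<sigma> \<Longrightarrow> diagonal \<sigma> \<bullet> f \<sigma> \<le> diagonal \<sigma> \<bullet> q"
    by blast+
  define H where "H = convex hull (range f)"
  have "convex (rect x (x + s) y (y + s))" unfolding rect_eq_box by (rule convex_box)
  moreover have "range f \<subseteq> rect x (x + s) y (y + s)"
  proof (rule image_subsetI)
    fix \<sigma>
    show "f \<sigma> \<in> rect x (x + s) y (y + s)"
      by (rule subsetD[OF corner_subset_cell f(2)]) (use assms(2-4) in simp_all)
  qed
  ultimately have Hcell: "H \<subseteq> rect x (x + s) y (y + s)"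
    unfolding H_def by (intro hull_minimal)
  \<comment> \<open>The line through \<open>f \<sigma>\<close> perpendicular to the diagonal has all
    of \<open>H\<close> on one closed side, so interior points are strictly on that side.\<close>
  have strict: "diagonal \<sigma> \<bullet> q < diagonal \<sigma> \<bullet> f \<sigma>" if "q \<in> interior H" for q \<sigma>
  proof -
    have "range f \<subseteq> {v. diagonal \<sigma> \<bullet> v \<le> diagonal \<sigma> \<bullet> f \<sigma>}"
    proof (rule image_subsetI)
      fix \<tau>
      show "f \<tau> \<in> {v. diagonal \<sigma> \<bullet> v \<le> diagonal \<sigma> \<bullet> f \<sigma>}"
        using diagonal_corner_le[OF assms(2-4) f(2) f(2), of \<tau> \<sigma>] by (cases "\<tau> = \<sigma>") simp_all
    qed
    then have "H \<subseteq> {v. diagonal \<sigma> \<bullet> v \<le> diagonal \<sigma> \<bullet> f \<sigma>}"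
      unfolding H_def by (intro hull_minimal convex_halfspace_le)
    then have "interior H \<subseteq> interior {v. diagonal \<sigma> \<bullet> v \<le> diagonal \<sigma> \<bullet> f \<sigma>}"
      by (rule interior_mono)
    moreover have "diagonal \<sigma> \<noteq> 0"
      by (auto simp: diagonal_def vec_eq_iff forall_2)
    ultimately show ?thesis
      using that by (auto simp: interior_halfspace_le)
  qed
  have int: "interior H \<inter> P = {}"
  proof (rule ccontr)
    assume "interior H \<inter> P \<noteq> {}"
    then obtain q where q: "q \<in> interior H" "q \<in> P" by blast
    then have "q \<in> rect x (x + s) y (y + s)" using Hcell interior_subset by blast
    then obtain \<sigma> where "q \<in> corner \<theta> s x y \<sigma>" using empty q(2) by blast
    \<comment> \<open>A point in a corner is no further in than the chosen one, while an interior
      point of \<open>H\<close> is strictly further in.\<close>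
    then show False using min[OF q(2)] strict[OF q(1), of \<sigma>] by fastforce
  qed
  let ?R = "rect (x + \<theta> * s) (x + (1 - \<theta>) * s) (y + \<theta> * s) (y + (1 - \<theta>) * s)"
  have RH: "?R \<subseteq> H" unfolding H_def using f(2) by (rule inner_square_subset_hull)
  have "\<theta> * s \<le> (1 - \<theta>) * s" using assms by (intro mult_right_mono) auto
  then have R: "measure lebesgue ?R = ((1 - 2 * \<theta>) * s)\<^sup>2"
    by (subst measure_rect) (auto simp: power2_eq_square algebra_simps)
  have fin: "finite (range f)" by simp
  have Hm: "H \<in> lmeasurable"
    unfolding H_def using fin by (intro lmeasurable_compact finite_imp_compact_convex_hull)
  have le: "((1 - 2 * \<theta>) * s)\<^sup>2 \<le> measure lebesgue H"
    unfolding R[symmetric] by (rule measure_mono_fmeasurable[OF RH _ Hm]) (rule fmeasurableD[OF rect_lmeasurable])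
  have "((1 - 2 * \<theta>) * s)\<^sup>2 > 0" using assms by simp
  with le have "measure lebesgue H \<noteq> 0" by linarith
  then have "aff_dim H = 2"
    using measure_lebesgue_nonfull_aff_dim[OF fin] unfolding H_def by fastforce
  moreover have "polytope H" unfolding H_def polytope_def using fin by blast
  moreover have "vertices H \<subseteq> P"
    unfolding vertices_def H_def using extreme_points_of_convex_hull[of "range f"] f(1) by blast
  moreover have "H \<subseteq> K" using Hcell cell by blast
  ultimately have "H \<in> polygonal_holes K P"
    using int by (simp add: polygonal_holes_def convex_polygon_def hole_def)
  then have "measure lebesgue H \<le> PolyMax K P"
    unfolding PolyMax_def using finite_polygonal_holes[OF assms(1)] by (intro Max_ge) auto
  with le show ?thesis by linarith
qed

section \<open>Second moment bound\<close>

text \<open>\<^term>\<open>a\<close> is the expected number of cells with \<^term>\<open>B c\<close> empty. Counting only the cells that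
  are also hit by all \<^term>\<open>H c \<sigma>\<close> lowers the first moment by a factor close to 1, while the second
  moment is still at most \<open>a + a\<^sup>2\<close>, as disjoint sets are missed with negative correlation.\<close>

lemma prob_no_good_cell:
  fixes B :: "'c \<Rightarrow> 'a set" and H :: "'c \<Rightarrow> 's \<Rightarrow> 'a set"
  assumes "prob_space M" "finite C" "finite \<Sigma>"
    and B: "\<And>c. c \<in> C \<Longrightarrow> B c \<in> sets M"
    and H: "\<And>c \<sigma>. c \<in> C \<Longrightarrow> \<sigma> \<in> \<Sigma> \<Longrightarrow> H c \<sigma> \<in> sets M"
    and disj: "\<And>c c'. c \<in> C \<Longrightarrow> c' \<in> C \<Longrightarrow> c \<noteq> c' \<Longrightarrow> B c \<inter> B c' = {}"
      "\<And>c \<sigma>. c \<in> C \<Longrightarrow> \<sigma> \<in> \<Sigma> \<Longrightarrow> B c \<inter> H c \<sigma> = {}"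
    and h: "\<And>c \<sigma>. c \<in> C \<Longrightarrow> \<sigma> \<in> \<Sigma> \<Longrightarrow> h \<le> measure M (H c \<sigma>)" "h \<le> 1"
    and a: "a = (\<Sum>c\<in>C. (1 - measure M (B c)) ^ n)" "a > 0"
  defines "P \<equiv> PiM {..<n} (\<lambda>_. M)"
  defines "E \<equiv> \<lambda>c. {x \<in> space P. (\<forall>l\<in>{..<n}. x l \<notin> B c) \<and> (\<forall>\<sigma>\<in>\<Sigma>. \<exists>l\<in>{..<n}. x l \<in> H c \<sigma>)}"
  shows "{x \<in> space P. \<forall>c\<in>C. x \<notin> E c} \<in> sets P"
    and "measure P {x \<in> space P. \<forall>c\<in>C. x \<notin> E c} \<le> 1 / a + 2 * (real (card \<Sigma>) * (1 - h) ^ n)"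
proof -
  interpret M: prob_space M by fact
  interpret P: prob_space P unfolding P_def by (rule prob_space_PiM) (rule assms(1))
  define p where "p c = (1 - measure M (B c)) ^ n" for c
  \<comment> \<open>Bounds the conditional probability, given that \<open>B c\<close> is empty, that
    some \<open>H c \<sigma>\<close> is also empty.\<close>
  define \<eta> where "\<eta> = real (card \<Sigma>) * (1 - h) ^ n"
  define A where "A S = {x \<in> space P. \<forall>l\<in>{..<n}. x l \<notin> S}" for S
  have p0: "p c \<ge> 0" for c unfolding p_def by simp
  have A_sets: "A S \<in> sets P" if "S \<in> sets M" for S
    unfolding A_def P_def using that by (rule avoid_in_sets) simp
  have A_prob: "measure P (A S) = (1 - measure M S) ^ n" if "S \<in> sets M" for S
    unfolding A_def P_def using prob_avoid[OF assms(1) that, of "{..<n}"] by simp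
  \<comment> \<open>Negative correlation in the form 1 - u - v \<le> (1 - u)(1 - v).\<close>
  have A_disj: "measure P (A (S \<union> T)) \<le> (1 - measure M S) ^ n * (1 - measure M T) ^ n"
    if "S \<in> sets M" "T \<in> sets M" "S \<inter> T = {}" for S T
  proof -
    have u: "measure M (S \<union> T) = measure M S + measure M T"
      using that by (intro M.finite_measure_Union)
    have "measure P (A (S \<union> T)) = (1 - (measure M S + measure M T)) ^ n"
      using that unfolding u[symmetric] by (intro A_prob) auto
    also have "\<dots> \<le> ((1 - measure M S) * (1 - measure M T)) ^ n"
    proof (rule power_mono)
      have "0 \<le> measure M S * measure M T" by simp
      then show "1 - (measure M S + measure M T) \<le> (1 - measure M S) * (1 - measure M T)"
        by (simp add: algebra_simps)
      show "0 \<le> 1 - (measure M S + measure M T)"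
        unfolding u[symmetric] by simp
    qed
    finally show ?thesis by (simp only: power_mult_distrib)
  qed
  have E_eq: "E c = A (B c) - (\<Union>\<sigma>\<in>\<Sigma>. A (H c \<sigma>))" for c
    unfolding E_def A_def by blast
  have E_sets: "E c \<in> sets P" if "c \<in> C" for c
    unfolding E_eq using that B H assms(3) by (intro sets.Diff sets.finite_UN A_sets) auto
  have E_lower: "p c * (1 - \<eta>) \<le> measure P (E c)" if c: "c \<in> C" for c
  proof -
    \<comment> \<open>If \<open>B c\<close> is empty but the cell is not good, some
      \<open>H c \<sigma>\<close> is empty as well.\<close>
    have "A (B c) \<subseteq> E c \<union> (\<Union>\<sigma>\<in>\<Sigma>. A (B c \<union> H c \<sigma>))"
      unfolding E_eq A_def by blast
    then have "p c \<le> measure P (E c \<union> (\<Union>\<sigma>\<in>\<Sigma>. A (B c \<union> H c \<sigma>)))"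
      unfolding p_def A_prob[OF B[OF c], symmetric]
      using c B H assms(3) by (intro P.finite_measure_mono sets.Un sets.finite_UN E_sets A_sets) auto
    also have "\<dots> \<le> measure P (E c) + measure P (\<Union>\<sigma>\<in>\<Sigma>. A (B c \<union> H c \<sigma>))"
      using c B H assms(3) by (intro measure_Un_le sets.finite_UN E_sets A_sets sets.Un) auto
    also have "measure P (\<Union>\<sigma>\<in>\<Sigma>. A (B c \<union> H c \<sigma>)) \<le> (\<Sum>\<sigma>\<in>\<Sigma>. measure P (A (B c \<union> H c \<sigma>)))"
      using c B H assms(3) by (intro P.finite_measure_subadditive_finite) (auto intro!: A_sets)
    also have "\<dots> \<le> (\<Sum>\<sigma>\<in>\<Sigma>. p c * (1 - h) ^ n)"
    proof (rule sum_mono)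
      fix \<sigma> assume \<sigma>: "\<sigma> \<in> \<Sigma>"
      have "measure P (A (B c \<union> H c \<sigma>)) \<le> p c * (1 - measure M (H c \<sigma>)) ^ n"
        unfolding p_def by (rule A_disj[OF B[OF c] H[OF c \<sigma>] disj(2)[OF c \<sigma>]])
      also have "\<dots> \<le> p c * (1 - h) ^ n"
        using h(1)[OF c \<sigma>] p0 by (intro mult_left_mono power_mono) auto
      finally show "measure P (A (B c \<union> H c \<sigma>)) \<le> p c * (1 - h) ^ n" .
    qed
    also have "\<dots> = p c * \<eta>" by (simp add: \<eta>_def)
    finally show ?thesis by (simp add: algebra_simps)
  qed
  have E_upper: "measure P (E c) \<le> p c" if c: "c \<in> C" for c
    unfolding p_def A_prob[OF B[OF c], symmetric]
    by (rule P.finite_measure_mono[OF _ A_sets[OF B[OF c]]]) (auto simp: E_eq)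
  have E_pair: "measure P (E c \<inter> E c') \<le> p c * p c'" if c: "c \<in> C" "c' \<in> C" "c \<noteq> c'" for c c'
  proof -
    have "measure P (E c \<inter> E c') \<le> measure P (A (B c \<union> B c'))"
      using c B by (intro P.finite_measure_mono A_sets) (auto simp: E_eq A_def)
    also have "\<dots> \<le> p c * p c'"
      unfolding p_def using c by (intro A_disj B disj)
    finally show ?thesis .
  qed
  define X where "X c x = (indicator (E c) x :: real)" for c x
  have X_int: "integrable P (X c)" and X_exp: "integral\<^sup>L P (X c) = measure P (E c)" if "c \<in> C" for c
    unfolding X_def using E_sets[OF that] by (simp_all add: P.emeasure_eq_measure)
  have XX: "X c x * X c' x = indicator (E c \<inter> E c') x" for c c' x
    unfolding X_def by (simp add: indicator_inter_arith)
  have XX_int: "integrable P (\<lambda>x. X c x * X c' x)"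
    and XX_exp: "integral\<^sup>L P (\<lambda>x. X c x * X c' x) = measure P (E c \<inter> E c')" if "c \<in> C" "c' \<in> C" for c c'
    unfolding XX using E_sets[OF that(1)] E_sets[OF that(2)] by (simp_all add: P.emeasure_eq_measure)
  define Y where "Y x = (\<Sum>c\<in>C. X c x)" for x
  \<comment> \<open>This is the squared deviation of the number \<open>Y\<close> of good cells from
    \<open>a\<close>, expanded for integration. The centre \<open>a\<close> may exceed the mean of
    \<open>Y\<close>; the difference is controlled by \<open>\<eta>\<close>.\<close>
  define F where "F x = (\<Sum>c\<in>C. \<Sum>c'\<in>C. X c x * X c' x) - 2 * a * (\<Sum>c\<in>C. X c x) + a\<^sup>2" for x
  have F_eq: "F x = (Y x - a)\<^sup>2" for x
    unfolding F_def Y_def by (simp add: power2_eq_square sum_product algebra_simps)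
  have F_int: "integrable P F"
    unfolding F_def
    by (intro Bochner_Integration.integrable_add Bochner_Integration.integrable_diff
        integrable_mult_right Bochner_Integration.integrable_sum X_int XX_int) simp_all
  have "integral\<^sup>L P F = (\<Sum>c\<in>C. \<Sum>c'\<in>C. measure P (E c \<inter> E c')) - 2 * a * (\<Sum>c\<in>C. measure P (E c)) + a\<^sup>2"
  proof -
    have i1: "integrable P (\<lambda>x. \<Sum>c\<in>C. \<Sum>c'\<in>C. X c x * X c' x)" "integrable P (\<lambda>x. \<Sum>c\<in>C. X c x)"
      by (intro Bochner_Integration.integrable_sum X_int XX_int; assumption)+
    have "integral\<^sup>L P (\<lambda>x. \<Sum>c\<in>C. \<Sum>c'\<in>C. X c x * X c' x) = (\<Sum>c\<in>C. integral\<^sup>L P (\<lambda>x. \<Sum>c'\<in>C. X c x * X c' x))"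
      by (intro Bochner_Integration.integral_sum Bochner_Integration.integrable_sum XX_int)
    also have "\<dots> = (\<Sum>c\<in>C. \<Sum>c'\<in>C. measure P (E c \<inter> E c'))"
    proof (rule sum.cong[OF refl])
      fix c assume c: "c \<in> C"
      show "integral\<^sup>L P (\<lambda>x. \<Sum>c'\<in>C. X c x * X c' x) = (\<Sum>c'\<in>C. measure P (E c \<inter> E c'))"
        by (subst Bochner_Integration.integral_sum) (auto intro!: XX_int XX_exp sum.cong c)
    qed
    finally have 1: "integral\<^sup>L P (\<lambda>x. \<Sum>c\<in>C. \<Sum>c'\<in>C. X c x * X c' x) = (\<Sum>c\<in>C. \<Sum>c'\<in>C. measure P (E c \<inter> E c'))" .
    have 2: "integral\<^sup>L P (\<lambda>x. \<Sum>c\<in>C. X c x) = (\<Sum>c\<in>C. measure P (E c))"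
      by (subst Bochner_Integration.integral_sum) (auto intro!: X_int X_exp sum.cong)
    show ?thesis
      unfolding F_def using i1 by (simp add: 1 2 P.prob_space)
  qed
  also have "\<dots> \<le> (a + a\<^sup>2) - 2 * a * (a * (1 - \<eta>)) + a\<^sup>2"
  proof -
    \<comment> \<open>The diagonal term contributes \<open>p c\<close>, the pairs of distinct cells
      at most \<open>p c * a\<close>.\<close>
    have "(\<Sum>c'\<in>C. measure P (E c \<inter> E c')) \<le> p c + p c * a" if c: "c \<in> C" for c
    proof -
      have "(\<Sum>c'\<in>C. measure P (E c \<inter> E c')) = measure P (E c) + (\<Sum>c'\<in>C - {c}. measure P (E c \<inter> E c'))"
        using sum.remove[OF assms(2) c, of "\<lambda>c'. measure P (E c \<inter> E c')"] by (simp only: Int_absorb)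
      also have "\<dots> \<le> p c + (\<Sum>c'\<in>C - {c}. p c * p c')"
        using E_upper[OF c] E_pair[OF c] by (intro add_mono sum_mono) auto
      also have "(\<Sum>c'\<in>C - {c}. p c * p c') \<le> (\<Sum>c'\<in>C. p c * p c')"
        using assms(2) p0 by (intro sum_mono2) auto
      also have "\<dots> = p c * a"
        unfolding a(1) p_def[symmetric] by (simp add: sum_distrib_left)
      finally show ?thesis by simp
    qed
    then have "(\<Sum>c\<in>C. \<Sum>c'\<in>C. measure P (E c \<inter> E c')) \<le> (\<Sum>c\<in>C. p c + p c * a)"
      by (rule sum_mono)
    also have "\<dots> = a + a\<^sup>2"
      unfolding sum.distrib sum_distrib_right[symmetric] p_def a(1)[symmetric] by (simp add: power2_eq_square)
    finally have 1: "(\<Sum>c\<in>C. \<Sum>c'\<in>C. measure P (E c \<inter> E c')) \<le> a + a\<^sup>2" .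
    have "a * (1 - \<eta>) = (\<Sum>c\<in>C. p c * (1 - \<eta>))"
      unfolding a(1) p_def by (simp add: sum_distrib_right)
    also have "\<dots> \<le> (\<Sum>c\<in>C. measure P (E c))" by (intro sum_mono E_lower)
    finally have "2 * a * (a * (1 - \<eta>)) \<le> 2 * a * (\<Sum>c\<in>C. measure P (E c))"
      using a(2) by (intro mult_left_mono) auto
    with 1 show ?thesis by linarith
  qed
  also have "\<dots> = a\<^sup>2 * (1 / a + 2 * \<eta>)"
    using a(2) by (simp add: power2_eq_square field_simps)
  finally have upper: "integral\<^sup>L P F \<le> a\<^sup>2 * (1 / a + 2 * \<eta>)" .
  let ?N = "{x \<in> space P. \<forall>c\<in>C. x \<notin> E c}"
  show N_sets: "?N \<in> sets P"
  proof -
    have "?N = space P - (\<Union>c\<in>C. E c)" by blast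
    then show ?thesis using assms(2) E_sets by (simp add: sets.finite_UN sets.Diff)
  qed
  \<comment> \<open>As in Chebyshev's inequality: without good cells \<open>Y\<close> is 0, and then
    \<open>F\<close> equals the square of \<open>a\<close>.\<close>
  have "a\<^sup>2 * measure P ?N = integral\<^sup>L P (\<lambda>x. a\<^sup>2 * indicator ?N x)"
    using N_sets by simp
  also have "\<dots> \<le> integral\<^sup>L P F"
  proof (rule integral_mono[OF _ F_int])
    show "integrable P (\<lambda>x. a\<^sup>2 * indicator ?N x)"
      using N_sets by (intro integrable_mult_right) (simp add: P.emeasure_eq_measure)
    fix x assume "x \<in> space P"
    show "a\<^sup>2 * indicator ?N x \<le> F x"
    proof (cases "x \<in> ?N")
      case True
      then have "Y x = 0" unfolding Y_def X_def by (intro sum.neutral) auto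
      with True show ?thesis by (simp add: F_eq)
    next
      case False
      then show ?thesis by (simp add: F_eq)
    qed
  qed
  also note upper
  finally have "measure P ?N \<le> 1 / a + 2 * \<eta>" using a(2) by simp
  then show "measure P ?N \<le> 1 / a + 2 * (real (card \<Sigma>) * (1 - h) ^ n)" unfolding \<eta>_def .
qed

section \<open>The two tails\<close>

text \<open>A convex set with empty interior is negligible, so \<open>K\<close> contains a
  ball.\<close>

lemma unit_area_contains_square:
  assumes "convex K" "measure lebesgue K = 1"
  obtains x y L where "L > 0" "rect x (x + L) y (y + L) \<subseteq> K"
proof -
  have "\<not> negligible K" using assms(2) negligible_imp_measure0[of K] by auto
  then obtain z where "z \<in> interior K" using negligible_convex_interior[OF assms(1)] by blast
  then obtain e where e: "e > 0" "ball z e \<subseteq> K" by (auto simp: mem_interior)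
  have "rect (z $ 1) (z $ 1 + e / 2) (z $ 2) (z $ 2 + e / 2) \<subseteq> ball z e"
  proof
    fix v assume v: "v \<in> rect (z $ 1) (z $ 1 + e / 2) (z $ 2) (z $ 2 + e / 2)"
    have "norm (v - z) \<le> \<bar>(v - z) $ 1\<bar> + \<bar>(v - z) $ 2\<bar>"
      using norm_le_l1_cart[of "v - z"] by (simp add: sum_2)
    also have "\<dots> < e" using v by (simp add: rect_def)
    finally show "v \<in> ball z e" by (simp add: dist_norm norm_minus_commute)
  qed
  with e show thesis by (intro that[of "e / 2" "z $ 1" "z $ 2"]) auto
qed

text \<open>The square contains k^2 disjoint cells of side \<open>s\<close>. A cell that is empty
  off its corners and hit in every corner forces a large hole, so the second moment bound applies.
  The factor 8 is twice the number of corners.\<close>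

lemma prob_PolyMax_less:
  assumes "convex K" "measure lebesgue K = 1"
    and sq: "rect x0 (x0 + L) y0 (y0 + L) \<subseteq> K"
    and s: "0 < s" "s < 1" "real k * s \<le> L" and k: "k > 0" and \<theta>: "0 < \<theta>" "\<theta> < 1/4"
  shows "measure (uniform_points K n) {x \<in> space (uniform_points K n). PolyMax K (x ` {..<n}) < ((1 - 2 * \<theta>) * s)\<^sup>2}
    \<le> 1 / ((real k)\<^sup>2 * (1 - s\<^sup>2) ^ n) + 8 * (1 - (\<theta> * s)\<^sup>2) ^ n"
proof -
  let ?M = "uniform_measure lebesgue K"
  let ?U = "uniform_points K n"
  interpret M: prob_space ?M using assms(2) by (rule prob_space_uniform_lebesgue)
  interpret U: prob_space ?U
    unfolding uniform_points_def by (intro prob_space_PiM M.prob_space_axioms)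
  define cell where "cell c = rect (x0 + real (fst c) * s) (x0 + real (fst c) * s + s)
      (y0 + real (snd c) * s) (y0 + real (snd c) * s + s)" for c :: "nat \<times> nat"
  define H where "H c = corner \<theta> s (x0 + real (fst c) * s) (y0 + real (snd c) * s)" for c :: "nat \<times> nat"
  define B where "B c = cell c - (\<Union>\<sigma>. H c \<sigma>)" for c
  define C where "C = {..<k} \<times> {..<k}"
  define E where "E c = {x \<in> space ?U. (\<forall>l\<in>{..<n}. x l \<notin> B c) \<and> (\<forall>\<sigma>\<in>UNIV. \<exists>l\<in>{..<n}. x l \<in> H c \<sigma>)}" for c
  have H_cell: "H c \<sigma> \<subseteq> cell c" for c \<sigma>
    unfolding H_def cell_def using s \<theta> by (intro corner_subset_cell) auto
  have cell_sets: "cell c \<in> sets lebesgue" and H_sets: "H c \<sigma> \<in> sets lebesgue" for c \<sigma>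
    unfolding cell_def H_def corner_def by (intro fmeasurableD rect_lmeasurable)+
  have B_sets: "B c \<in> sets lebesgue" for c
    unfolding B_def by (intro sets.Diff sets.finite_UN cell_sets H_sets) simp
  have cell_K: "cell c \<subseteq> K" if "c \<in> C" for c
  proof -
    have "real (fst c) * s + s \<le> L" "real (snd c) * s + s \<le> L"
    proof -
      have "(real i + 1) * s \<le> real k * s" if "i < k" for i
        using that s(1) by (intro mult_right_mono) auto
      then have "real i * s + s \<le> L" if "i < k" for i
        using that s(3) by (fastforce simp: distrib_right)
      then show "real (fst c) * s + s \<le> L" "real (snd c) * s + s \<le> L"
        using \<open>c \<in> C\<close> by (auto simp: C_def)
    qed
    moreover have "0 \<le> real (fst c) * s" "0 \<le> real (snd c) * s" using s(1) by auto
    ultimately have "cell c \<subseteq> rect x0 (x0 + L) y0 (y0 + L)"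
      unfolding cell_def rect_def by (intro subsetI CollectI; unfold mem_Collect_eq) linarith
    with sq show ?thesis by blast
  qed
  have cell_disj: "cell c \<inter> cell c' = {}" if "c \<noteq> c'" for c c'
  proof -
    have sep: "real i * s + s \<le> real j * s" if "i < j" for i j :: nat
    proof -
      have "(real i + 1) * s \<le> real j * s" using that s(1) by (intro mult_right_mono) auto
      then show ?thesis by (simp add: distrib_right)
    qed
    have "fst c \<noteq> fst c' \<or> snd c \<noteq> snd c'" using that by (auto simp: prod_eq_iff)
    then consider "fst c < fst c'" | "fst c' < fst c" | "snd c < snd c'" | "snd c' < snd c" by linarith
    then show ?thesis
    proof cases
      case 1 from sep[OF this] show ?thesis unfolding cell_def rect_def by auto
    next
      case 2 from sep[OF this] show ?thesis unfolding cell_def rect_def by auto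
    next
      case 3 from sep[OF this] show ?thesis unfolding cell_def rect_def by auto
    next
      case 4 from sep[OF this] show ?thesis unfolding cell_def rect_def by auto
    qed
  qed
  have M_eq: "measure ?M S = measure lebesgue S" if "c \<in> C" "S \<subseteq> cell c" "S \<in> sets lebesgue" for S c
    using that subset_trans[OF that(2) cell_K[OF that(1)]] by (intro measure_uniform_lebesgue assms(2))
  \<comment> \<open>The crude bound by the whole cell suffices: it makes the first moment at least
    k^2 (1 - s^2)^n.\<close>
  have B_le: "measure ?M (B c) \<le> s\<^sup>2" if "c \<in> C" for c
  proof -
    have "measure ?M (B c) \<le> measure ?M (cell c)"
      by (intro M.finite_measure_mono) (auto simp: B_def sets_uniform_lebesgue cell_sets)
    also have "\<dots> = measure lebesgue (cell c)"
      using that cell_sets by (intro M_eq) auto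
    also have "\<dots> = s\<^sup>2"
      unfolding cell_def using s(1) by (subst measure_rect) (auto simp: power2_eq_square)
    finally show ?thesis .
  qed
  have H_eq: "measure ?M (H c \<sigma>) = (\<theta> * s)\<^sup>2" if "c \<in> C" for c \<sigma>
    using M_eq[OF that H_cell H_sets, of \<sigma>] s \<theta> unfolding H_def by (simp add: measure_corner)
  define a where "a = (\<Sum>c\<in>C. (1 - measure ?M (B c)) ^ n)"
  have s2: "s\<^sup>2 < 1" using s by (simp add: power_less_one_iff)
  have "(real k)\<^sup>2 * (1 - s\<^sup>2) ^ n = (\<Sum>c\<in>C. (1 - s\<^sup>2) ^ n)"
    by (simp add: C_def card_cartesian_product power2_eq_square)
  also have "\<dots> \<le> a"
    unfolding a_def using B_le s2 by (intro sum_mono power_mono) auto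
  finally have a_ge: "(real k)\<^sup>2 * (1 - s\<^sup>2) ^ n \<le> a" .
  have pos: "0 < (real k)\<^sup>2 * (1 - s\<^sup>2) ^ n" using k s2 by simp
  then have a_pos: "a > 0" using a_ge by linarith
  have h1: "(\<theta> * s)\<^sup>2 \<le> 1"
    using s \<theta> by (intro power_le_one mult_nonneg_nonneg mult_le_one) auto
  note second_moment = prob_no_good_cell[where M="?M" and C=C and \<Sigma>="UNIV :: (bool \<times> bool) set"
      and B=B and H=H and h="(\<theta> * s)\<^sup>2" and a=a and n=n, OF M.prob_space_axioms]
  have N: "{x \<in> space ?U. \<forall>c\<in>C. x \<notin> E c} \<in> sets ?U"
    "measure ?U {x \<in> space ?U. \<forall>c\<in>C. x \<notin> E c} \<le> 1 / a + 2 * (real (card (UNIV :: (bool \<times> bool) set)) * (1 - (\<theta> * s)\<^sup>2) ^ n)"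
    unfolding E_def uniform_points_def
  \<comment> \<open>Cases 5 and 6 are the two disjointness conditions; case 11 is the probability
    bound, where the same conditions recur.\<close>
  proof (rule second_moment(1), goal_cases)
    case 5 then show ?case using cell_disj unfolding B_def by blast
  next
    case 6 then show ?case unfolding B_def by blast
  next
    case 11
    show ?case
    proof (rule second_moment(2), goal_cases)
      case 5 then show ?case using cell_disj unfolding B_def by blast
    next
      case 6 then show ?case unfolding B_def by blast
    qed (use B_sets H_sets H_eq h1 a_pos in \<open>simp_all add: C_def sets_uniform_lebesgue a_def\<close>)
  qed (use B_sets H_sets H_eq h1 a_pos in \<open>simp_all add: C_def sets_uniform_lebesgue a_def\<close>)
  have sub: "{x \<in> space ?U. PolyMax K (x ` {..<n}) < ((1 - 2 * \<theta>) * s)\<^sup>2} \<subseteq> {x \<in> space ?U. \<forall>c\<in>C. x \<notin> E c}"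
  proof (intro subsetI CollectI conjI ballI notI)
    fix x c assume x: "x \<in> {x \<in> space ?U. PolyMax K (x ` {..<n}) < ((1 - 2 * \<theta>) * s)\<^sup>2}"
      and c: "c \<in> C" "x \<in> E c"
    have "((1 - 2 * \<theta>) * s)\<^sup>2 \<le> PolyMax K (x ` {..<n})"
    proof (rule PolyMax_ge_inner_square[OF _ \<theta> s(1)])
      show "rect (x0 + real (fst c) * s) (x0 + real (fst c) * s + s)
          (y0 + real (snd c) * s) (y0 + real (snd c) * s + s) \<subseteq> K"
        using cell_K[OF c(1)] unfolding cell_def .
      show "x ` {..<n} \<inter> rect (x0 + real (fst c) * s) (x0 + real (fst c) * s + s)
          (y0 + real (snd c) * s) (y0 + real (snd c) * s + s)
          \<subseteq> (\<Union>\<sigma>. corner \<theta> s (x0 + real (fst c) * s) (y0 + real (snd c) * s) \<sigma>)"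
        using c(2) unfolding E_def B_def cell_def H_def by blast
      show "x ` {..<n} \<inter> corner \<theta> s (x0 + real (fst c) * s) (y0 + real (snd c) * s) \<sigma> \<noteq> {}" for \<sigma>
        using c(2) unfolding E_def H_def by blast
    qed simp
    with x show False by simp
  qed simp
  have "measure ?U {x \<in> space ?U. PolyMax K (x ` {..<n}) < ((1 - 2 * \<theta>) * s)\<^sup>2}
      \<le> measure ?U {x \<in> space ?U. \<forall>c\<in>C. x \<notin> E c}"
    by (rule U.finite_measure_mono[OF sub N(1)])
  also note N(2)
  also have "1 / a \<le> 1 / ((real k)\<^sup>2 * (1 - s\<^sup>2) ^ n)"
    by (rule divide_left_mono[OF a_ge _ mult_pos_pos[OF a_pos pos]]) simp
  finally show ?thesis by simp
qed

lemma upper_tail_tendsto_0: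
  "(\<lambda>n. real n ^ 3 * c * (1 - 361/400 * (4 * (ln (real n) / real n))) ^ (n - 3)) \<longlonglongrightarrow> 0"
proof (rule Lim_null_comparison)
  \<comment> \<open>By 1 - q \<le> exp (- q) the quantity has order at most n^(3 - 361/100), and
    361/100 > 3.\<close>
  define q where "q n = 361/100 * (ln (real n) / real n)" for n
  show "(\<lambda>n. \<bar>c\<bar> * (real n ^ 3 * exp (- (q n * (real n - 3))))) \<longlonglongrightarrow> 0"
    unfolding q_def by real_asymp
  have "eventually (\<lambda>n. q n \<le> 1) sequentially"
    unfolding q_def by real_asymp
  then show "\<forall>\<^sub>F n in sequentially.
      norm (real n ^ 3 * c * (1 - 361/400 * (4 * (ln (real n) / real n))) ^ (n - 3))
      \<le> \<bar>c\<bar> * (real n ^ 3 * exp (- (q n * (real n - 3))))"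
    using eventually_ge_at_top[of 3]
  proof eventually_elim
    case (elim n)
    have "(1 - q n) ^ (n - 3) \<le> exp (- q n) ^ (n - 3)"
      using elim(1) exp_ge_add_one_self[of "- q n"] by (intro power_mono) auto
    also have "\<dots> = exp (- (q n * (real n - 3)))"
      using elim(2) by (simp add: exp_of_nat_mult[symmetric] of_nat_diff algebra_simps)
    finally have "(1 - q n) ^ (n - 3) \<le> exp (- (q n * (real n - 3)))" .
    then have "\<bar>c\<bar> * (real n ^ 3 * (1 - q n) ^ (n - 3)) \<le> \<bar>c\<bar> * (real n ^ 3 * exp (- (q n * (real n - 3))))"
      by (intro mult_left_mono) auto
    moreover have "norm (real n ^ 3 * c * (1 - q n) ^ (n - 3)) = \<bar>c\<bar> * (real n ^ 3 * (1 - q n) ^ (n - 3))"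
      using elim(1) by (simp add: abs_mult power_abs)
    moreover have "361/400 * (4 * (ln (real n) / real n)) = q n" by (simp add: q_def)
    ultimately show ?case by (simp only:)
  qed
qed

text \<open>The denominator behaves like n^(-\<beta>), so the quotient has order log n times
  n^(\<beta> - 1) for nonzero \<open>c\<close>. It bounds the reciprocal of the first
  moment.\<close>

lemma first_moment_tendsto_0:
  fixes \<beta> c :: real
  assumes "0 < \<beta>" "\<beta> < 1"
  shows "(\<lambda>n. c * (\<beta> * (ln (real n) / real n)) / (1 - \<beta> * (ln (real n) / real n)) ^ n) \<longlonglongrightarrow> 0"
proof (rule Lim_transform_eventually)
  show "(\<lambda>n. c * (\<beta> * (ln (real n) / real n)) / exp (real n * ln (1 - \<beta> * (ln (real n) / real n)))) \<longlonglongrightarrow> 0"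
    using assms by real_asymp
  have "eventually (\<lambda>n. 1 - \<beta> * (ln (real n) / real n) > 0) sequentially"
    using assms by real_asymp
  then show "\<forall>\<^sub>F n in sequentially.
      c * (\<beta> * (ln (real n) / real n)) / exp (real n * ln (1 - \<beta> * (ln (real n) / real n))) =
      c * (\<beta> * (ln (real n) / real n)) / (1 - \<beta> * (ln (real n) / real n)) ^ n"
    by eventually_elim (simp add: exp_of_nat_mult)
qed

text \<open>The power behaves like n^(-\<kappa>).\<close>

lemma corner_miss_tendsto_0:
  fixes \<kappa> :: real
  assumes "0 < \<kappa>"
  shows "(\<lambda>n. 8 * (1 - \<kappa> * (ln (real n) / real n)) ^ n) \<longlonglongrightarrow> 0"
proof (rule Lim_transform_eventually)
  show "(\<lambda>n. 8 * exp (real n * ln (1 - \<kappa> * (ln (real n) / real n)))) \<longlonglongrightarrow> 0"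
    using assms by real_asymp
  have "eventually (\<lambda>n. 1 - \<kappa> * (ln (real n) / real n) > 0) sequentially"
    using assms by real_asymp
  then show "\<forall>\<^sub>F n in sequentially. 8 * exp (real n * ln (1 - \<kappa> * (ln (real n) / real n))) =
      8 * (1 - \<kappa> * (ln (real n) / real n)) ^ n"
    by eventually_elim (simp add: exp_of_nat_mult)
qed

text \<open>The event is contained in that of exceeding \<open>4 * (ln (real n) / real n)\<close>,
  whose probability already tends to 0.\<close>

lemma upper_tail:
  assumes "convex K" "measure lebesgue K = 1" "\<epsilon> > 0"
  shows "(\<lambda>n. measure (uniform_points K n)
      {x \<in> space (uniform_points K n). (4 + \<epsilon>) * (ln (real n) / real n) < PolyMax K (x ` {..<n})}) \<longlonglongrightarrow> 0"
    (is "(\<lambda>n. ?p n) \<longlonglongrightarrow> 0")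
proof (rule Lim_null_comparison)
  show "(\<lambda>n. real n ^ 3 * real (card (Pow grid)) * (1 - 361/400 * (4 * (ln (real n) / real n))) ^ (n - 3)) \<longlonglongrightarrow> 0"
    by (rule upper_tail_tendsto_0)
  have "eventually (\<lambda>n. 361/400 * (4 * (ln (real n) / real n)) \<le> 1) sequentially" by real_asymp
  then show "\<forall>\<^sub>F n in sequentially. norm (?p n)
      \<le> real n ^ 3 * real (card (Pow grid)) * (1 - 361/400 * (4 * (ln (real n) / real n))) ^ (n - 3)"
    using eventually_ge_at_top[of 1]
  proof eventually_elim
    case (elim n)
    interpret U: prob_space "uniform_points K n"
      unfolding uniform_points_def by (intro prob_space_PiM prob_space_uniform_lebesgue assms(2))
    let ?r = "4 * (ln (real n) / real n)"
    have "0 \<le> ln (real n) / real n" using elim(2) by simp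
    then have r: "?r \<ge> 0" "?r \<le> (4 + \<epsilon>) * (ln (real n) / real n)"
      using assms(3) by (simp, intro mult_right_mono) simp_all
    have "?p n \<le> measure (uniform_points K n) {x \<in> space (uniform_points K n). ?r < PolyMax K (x ` {..<n})}"
    proof (rule U.finite_measure_mono)
      show "{x \<in> space (uniform_points K n). ?r < PolyMax K (x ` {..<n})} \<in> sets (uniform_points K n)"
        using measurable_PolyMax[OF assms(1) unit_area_sets[OF assms(2)], of n]
        by (rule borel_measurable_less[OF borel_measurable_const])
      show "{x \<in> space (uniform_points K n). (4 + \<epsilon>) * (ln (real n) / real n) < PolyMax K (x ` {..<n})}
          \<subseteq> {x \<in> space (uniform_points K n). ?r < PolyMax K (x ` {..<n})}"
        using r(2) by force
    qed
    also have "\<dots> \<le> real n ^ 3 * real (card (Pow grid)) * (1 - 361/400 * ?r) ^ (n - 3)"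
      using r(1) elim(1) by (intro prob_PolyMax_greater assms) auto
    finally show ?case by simp
  qed
qed

lemma lower_tail:
  assumes "convex K" "measure lebesgue K = 1" "\<epsilon> > 0"
  shows "(\<lambda>n. measure (uniform_points K n)
      {x \<in> space (uniform_points K n). PolyMax K (x ` {..<n}) < (1 - \<epsilon>) * (ln (real n) / real n)}) \<longlonglongrightarrow> 0"
    (is "(\<lambda>n. ?p n) \<longlonglongrightarrow> 0")
proof -
  obtain x y L where L: "L > 0" "rect x (x + L) y (y + L) \<subseteq> K"
    using unit_area_contains_square[OF assms(1,2)] .
  \<comment> \<open>The cap 1/2 keeps \<open>\<beta>\<close> and \<open>\<theta>\<close> in the
    required ranges for large \<open>\<epsilon>\<close>. Here \<open>\<beta> < 1\<close> makes the
    first moment diverge, and \<open>\<theta>\<close> limits the area lost at the corners.\<close>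
  define \<delta> where "\<delta> = min \<epsilon> (1/2)"
  define \<beta> where "\<beta> = 1 - \<delta> / 2"
  define \<theta> where "\<theta> = \<delta> / 16"
  define s where "s n = sqrt (\<beta> * (ln (real n) / real n))" for n
  define k where "k n = nat \<lfloor>L / s n\<rfloor>" for n
  have \<delta>: "0 < \<delta>" "\<delta> \<le> 1/2" "\<delta> \<le> \<epsilon>" using assms(3) by (auto simp: \<delta>_def)
  have \<beta>: "0 < \<beta>" "\<beta> < 1" and \<theta>: "0 < \<theta>" "\<theta> < 1/4" using \<delta> by (auto simp: \<beta>_def \<theta>_def)
  \<comment> \<open>Equivalently, the coefficient of log n / n in the area of the inner square is at
    least 1 - \<delta>.\<close>
  have "\<delta> \<le> (1 - 2 * \<theta>)\<^sup>2 * \<beta> - (1 - 2 * \<delta>)"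
  proof -
    have "(1 - 2 * \<theta>)\<^sup>2 * \<beta> - (1 - 2 * \<delta>) - \<delta> = \<delta> / 4 + \<delta>\<^sup>2 * (9/64 - \<delta> / 128)"
      unfolding \<theta>_def \<beta>_def by (simp add: power2_eq_square field_simps)
    moreover have "0 \<le> \<delta>\<^sup>2 * (9/64 - \<delta> / 128)" using \<delta> by (intro mult_nonneg_nonneg) auto
    ultimately show ?thesis using \<delta>(1) by linarith
  qed
  then have const: "1 - \<epsilon> \<le> (1 - 2 * \<theta>)\<^sup>2 * \<beta>" using \<delta>(3) by linarith
  show ?thesis
  proof (rule Lim_null_comparison)
    show "(\<lambda>n. 4 / L\<^sup>2 * (\<beta> * (ln (real n) / real n)) / (1 - \<beta> * (ln (real n) / real n)) ^ n
        + 8 * (1 - (\<theta>\<^sup>2 * \<beta>) * (ln (real n) / real n)) ^ n) \<longlonglongrightarrow> 0"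
      using \<beta> \<theta> by (intro tendsto_add_zero first_moment_tendsto_0 corner_miss_tendsto_0) auto
    have "eventually (\<lambda>n. 0 < \<beta> * (ln (real n) / real n)) sequentially" using \<beta> by real_asymp
    moreover have "eventually (\<lambda>n. \<beta> * (ln (real n) / real n) < 1) sequentially" using \<beta> by real_asymp
    moreover have "eventually (\<lambda>n. \<beta> * (ln (real n) / real n) < (L / 2)\<^sup>2) sequentially"
    proof -
      have "0 < (L / 2)\<^sup>2" using L(1) by simp
      moreover have "(\<lambda>n. \<beta> * (ln (real n) / real n)) \<longlonglongrightarrow> 0" by real_asymp
      ultimately show ?thesis by (rule order_tendstoD(2)[rotated])
    qed
    ultimately show "\<forall>\<^sub>F n in sequentially. norm (?p n)
        \<le> 4 / L\<^sup>2 * (\<beta> * (ln (real n) / real n)) / (1 - \<beta> * (ln (real n) / real n)) ^ n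
        + 8 * (1 - (\<theta>\<^sup>2 * \<beta>) * (ln (real n) / real n)) ^ n"
    proof eventually_elim
      case (elim n)
      interpret U: prob_space "uniform_points K n"
        unfolding uniform_points_def by (intro prob_space_PiM prob_space_uniform_lebesgue assms(2))
      have s2: "(s n)\<^sup>2 = \<beta> * (ln (real n) / real n)" using elim(1) by (simp add: s_def)
      have s: "0 < s n" "s n < 1" "s n < L / 2"
        unfolding s_def using elim L(1) real_less_lsqrt[OF _ elim(3)] by simp_all
      have Ls: "2 \<le> L / s n" using s by (simp add: field_simps)
      have k_le: "real (k n) \<le> L / s n" and k_gt: "L / s n < real (k n) + 1"
        using Ls unfolding k_def by linarith+
      \<comment> \<open>As \<open>L / s n\<close> is at least 2, rounding down loses at most a
        factor of 2; squared, this gives the constant \<open>4 / L\<^sup>2\<close>.\<close>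
      have k_half: "L / (2 * s n) \<le> real (k n)"
      proof -
        have "L / (2 * s n) = (L / s n) / 2" by simp
        then show ?thesis using k_gt Ls by linarith
      qed
      have pos: "0 < L / (2 * s n)" using L(1) s(1) by simp
      have k0: "k n > 0" using k_half pos by linarith
      have ks: "real (k n) * s n \<le> L" using k_le s(1) by (simp add: field_simps)
      have "(1 - \<epsilon>) * (ln (real n) / real n) \<le> ((1 - 2 * \<theta>)\<^sup>2 * \<beta>) * (ln (real n) / real n)"
        using zero_less_mult_pos[OF elim(1) \<beta>(1)] by (intro mult_right_mono const) simp
      also have "\<dots> = ((1 - 2 * \<theta>) * s n)\<^sup>2"
        by (simp add: power_mult_distrib s2)
      finally have le: "(1 - \<epsilon>) * (ln (real n) / real n) \<le> ((1 - 2 * \<theta>) * s n)\<^sup>2" .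
      have "?p n \<le> measure (uniform_points K n)
          {x \<in> space (uniform_points K n). PolyMax K (x ` {..<n}) < ((1 - 2 * \<theta>) * s n)\<^sup>2}"
      proof (rule U.finite_measure_mono)
        show "{x \<in> space (uniform_points K n). PolyMax K (x ` {..<n}) < ((1 - 2 * \<theta>) * s n)\<^sup>2} \<in> sets (uniform_points K n)"
          using measurable_PolyMax[OF assms(1) unit_area_sets[OF assms(2)], of n]
          by (rule borel_measurable_less[OF _ borel_measurable_const])
        show "{x \<in> space (uniform_points K n). PolyMax K (x ` {..<n}) < (1 - \<epsilon>) * (ln (real n) / real n)}
            \<subseteq> {x \<in> space (uniform_points K n). PolyMax K (x ` {..<n}) < ((1 - 2 * \<theta>) * s n)\<^sup>2}"
          using le by force
      qed
      also have "\<dots> \<le> 1 / ((real (k n))\<^sup>2 * (1 - (s n)\<^sup>2) ^ n) + 8 * (1 - (\<theta> * s n)\<^sup>2) ^ n"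
        by (rule prob_PolyMax_less[OF assms(1,2) L(2) s(1,2) ks k0 \<theta>])
      also have "1 / ((real (k n))\<^sup>2 * (1 - (s n)\<^sup>2) ^ n) \<le> 1 / ((L / (2 * s n))\<^sup>2 * (1 - (s n)\<^sup>2) ^ n)"
      proof (rule divide_left_mono)
        have p: "0 < (1 - (s n)\<^sup>2) ^ n" using elim(2) s2 by simp
        then show "(L / (2 * s n))\<^sup>2 * (1 - (s n)\<^sup>2) ^ n \<le> (real (k n))\<^sup>2 * (1 - (s n)\<^sup>2) ^ n"
          using k_half pos by (intro mult_right_mono power_mono) auto
        show "0 < (real (k n))\<^sup>2 * (1 - (s n)\<^sup>2) ^ n * ((L / (2 * s n))\<^sup>2 * (1 - (s n)\<^sup>2) ^ n)"
          using p k0 pos by (intro mult_pos_pos) auto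
      qed simp
      also have "1 / ((L / (2 * s n))\<^sup>2 * (1 - (s n)\<^sup>2) ^ n) = 4 / L\<^sup>2 * (s n)\<^sup>2 / (1 - (s n)\<^sup>2) ^ n"
        using L(1) s(1) by (simp add: power_divide power_mult_distrib)
      also have "(\<theta> * s n)\<^sup>2 = (\<theta>\<^sup>2 * \<beta>) * (ln (real n) / real n)"
        by (simp add: power_mult_distrib s2)
      finally show ?case unfolding s2 by simp
    qed
  qed
qed

theorem theorem1p3:
  fixes K :: "(real^2) set"
  assumes "convex K" and "measure lebesgue K = 1"
  shows "\<forall>\<epsilon>>0. (\<lambda>n. \<P>(x in uniform_points K n.
            (1 - \<epsilon>) * (ln (real n) / real n) \<le> PolyMax K (x ` {..<n}) \<and>
            PolyMax K (x ` {..<n}) \<le> (4 + \<epsilon>) * (ln (real n) / real n))) \<longlonglongrightarrow> 1"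
proof (intro allI impI)
  fix \<epsilon> :: real assume \<epsilon>: "\<epsilon> > 0"
  define low where "low n = {x \<in> space (uniform_points K n).
      PolyMax K (x ` {..<n}) < (1 - \<epsilon>) * (ln (real n) / real n)}" for n
  define high where "high n = {x \<in> space (uniform_points K n).
      (4 + \<epsilon>) * (ln (real n) / real n) < PolyMax K (x ` {..<n})}" for n
  define good where "good n = {x \<in> space (uniform_points K n).
      (1 - \<epsilon>) * (ln (real n) / real n) \<le> PolyMax K (x ` {..<n}) \<and>
      PolyMax K (x ` {..<n}) \<le> (4 + \<epsilon>) * (ln (real n) / real n)}" for n
  have prob: "prob_space (uniform_points K n)" for n
    unfolding uniform_points_def by (intro prob_space_PiM prob_space_uniform_lebesgue assms(2))
  \<comment> \<open>The good event is the complement of the two tail events, which are defined by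
    strict inequalities.\<close>
  have lower: "1 - measure (uniform_points K n) (low n) - measure (uniform_points K n) (high n)
      \<le> measure (uniform_points K n) (good n)" for n
  proof -
    interpret U: prob_space "uniform_points K n" by (rule prob)
    note meas = measurable_PolyMax[OF assms(1) unit_area_sets[OF assms(2)], of n]
    have sets: "low n \<in> U.events" "high n \<in> U.events"
      unfolding low_def high_def
      by (rule borel_measurable_less[OF meas borel_measurable_const],
          rule borel_measurable_less[OF borel_measurable_const meas])
    have "good n = space (uniform_points K n) - (low n \<union> high n)"
      unfolding good_def low_def high_def by auto
    then have "U.prob (good n) = 1 - U.prob (low n \<union> high n)"
      using sets by (simp add: U.prob_compl sets.Un)
    moreover have "U.prob (low n \<union> high n) \<le> U.prob (low n) + U.prob (high n)"
      using sets by (rule measure_Un_le)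
    ultimately show ?thesis by linarith
  qed
  have "(\<lambda>n. measure (uniform_points K n) (good n)) \<longlonglongrightarrow> 1"
  proof (rule tendsto_sandwich)
    show "(\<lambda>n. 1 - measure (uniform_points K n) (low n) - measure (uniform_points K n) (high n)) \<longlonglongrightarrow> 1"
      using tendsto_diff[OF tendsto_diff[OF tendsto_const[of 1] lower_tail[OF assms \<epsilon>]] upper_tail[OF assms \<epsilon>]]
      unfolding low_def high_def by simp
    show "\<forall>\<^sub>F n in sequentially. measure (uniform_points K n) (good n) \<le> 1"
      using prob_space.prob_le_1[OF prob] by simp
  qed (use lower in simp_all)
  then show "(\<lambda>n. \<P>(x in uniform_points K n.
            (1 - \<epsilon>) * (ln (real n) / real n) \<le> PolyMax K (x ` {..<n}) \<and>
            PolyMax K (x ` {..<n}) \<le> (4 + \<epsilon>) * (ln (real n) / real n))) \<longlonglongrightarrow> 1"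
    unfolding good_def .
qed

end
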